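(* The invariant polynomials in each $I_k$ are constant on $P^2\mathbb{O}$. Consequently, restricting polynomial functions to $P^2\mathbb{O}$, the decompositions $\mathcal{P}_k[\mathcal{J}(3)]=H_k+I_1H_{k-1}+\cdots+I_k$ $(k\ge0)$ together express the subspace of $C^\infty(P^2\mathbb{O})$ consisting of restrictions of polynomials as $$\sum_{k=0}^{\infty}{H_k}_{|P^2\mathbb{O}},$$ and this subspace is dense in $C^\infty(P^2\mathbb{O})$.
   Context: $\mathbb{O}$ is the octonions with conjugation $\theta$ and standard basis $\mathbf e_0=1,\dots,\mathbf e_7$. $\mathcal{J}(3)$ is the $27$-dimensional real space of matrices $A=\begin{pmatrix}\xi_1&z&\theta(y)\\ \theta(z)&\xi_2&x\\ y&\theta(x)&\xi_3\end{pmatrix}$, $\xi_i\in\mathbb{R}$, $x=\sum x_i\mathbf e_i$, $y=\sum y_i\mathbf e_i$, $z=\sum z_i\mathbf e_i\in\mathbb{O}$, with Jordan product $A\circ B=\frac12(AB+BA)$. $F_4$ is the group of $g\in GL(\mathcal{J}(3))$ with $g(A\circ B)=g(A)\circ g(B)$, $g(Id)=Id$. $P^2\mathbb{O}=\{X\in\mathcal{J}(3):X^2=X,\ \mathrm{tr}X=1\}$. $\mathcal{P}_k=\mathcal{P}_k[\mathcal{J}(3)]$ is the space of complex-valued homogeneous polynomials of degree $k$ in the $27$ coordinates $(z_i,y_i,x_i,\xi_1,\xi_2,\xi_3)$ (denoted $s_1,\dots,s_{27}$), $\mathbb{C}[\mathcal{J}(3)]=\sum_k\mathcal{P}_k$,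 with the Hermitian inner product $\ll s^\alpha,s^\beta\gg=\alpha!\,\delta_{\alpha,\beta}$ on monomials. $F_4$ acts by $Q\mapsto Q\circ g^{-1}$, and $I_k\subset\mathcal{P}_k$ is the subspace of $F_4$-invariant polynomials. The spaces $H_k\subset\mathcal{P}_k$ of Cayley harmonic polynomials are defined inductively: $H_0=\mathcal{P}_0$ (constants), and $H_k$ is the orthogonal complement in $\mathcal{P}_k$ of $\sum_{i=0}^{k-1}H_i\cdot I_{k-i}$, where $H_i\cdot I_j$ denotes the linear span of products. $C^\infty(P^2\mathbb{O})$ (complex valued functions) carries the $C^\infty$-topology. *)

theory Defs
  imports "HOL-Analysis.Analysis" "HOL-Library.Poly_Mapping"
begin

section \<open>Octonions\<close>

text \<open>Cayley-Dickson doubling, from \<open>complex\<close> to quaternions to octonions. As nested products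
  of \<open>complex\<close>, both carry the Euclidean structure of \<open>\<real>\<^sup>4\<close> and \<open>\<real>\<^sup>8\<close> in which the standard
  basis is orthonormal. The quaternion \<open>(a, b)\<close> is \<open>a + b j\<close>.\<close>

type_synonym quaternion = "complex \<times> complex"
type_synonym octonion = "quaternion \<times> quaternion"

definition qconj :: "quaternion \<Rightarrow> quaternion" where
  "qconj = (\<lambda>(a, b). (cnj a, - b))"

definition qmult :: "quaternion \<Rightarrow> quaternion \<Rightarrow> quaternion" where
  "qmult = (\<lambda>(a, b) (c, d). (a * c - cnj d * b, d * a + b * cnj c))"

definition oconj :: "octonion \<Rightarrow> octonion" where
  "oconj = (\<lambda>(p, q). (qconj p, - q))"

definition omult :: "octonion \<Rightarrow> octonion \<Rightarrow> octonion"  (infixl "\<odot>" 70) where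
  "omult = (\<lambda>(p, q) (r, s).
     (qmult p r - qmult (qconj s) q, qmult s p + qmult q (qconj r)))"

definition oreal :: "real \<Rightarrow> octonion" where
  "oreal r = ((complex_of_real r, 0), (0, 0))"

definition ore :: "octonion \<Rightarrow> real" where
  "ore x = Re (fst (fst x))"

text \<open>The coordinates with respect to the standard basis \<open>e\<^sub>0 = 1, \<dots>, e\<^sub>7\<close>.\<close>

definition ocoords :: "octonion \<Rightarrow> real list" where
  "ocoords = (\<lambda>((a, b), (c, d)). [Re a, Im a, Re b, Im b, Re c, Im c, Re d, Im d])"


section \<open>The Jordan algebra and the group $F_4$\<close>

text \<open>An element of the Jordan algebra is given by its coordinates \<open>(z, y, x, \<xi>\<^sub>1, \<xi>\<^sub>2, \<xi>\<^sub>3)\<close>;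
  \<open>jmat\<close> is the corresponding Hermitian octonionic matrix.\<close>

type_synonym jordan = "octonion \<times> octonion \<times> octonion \<times> real \<times> real \<times> real"

definition jmat :: "jordan \<Rightarrow> octonion ^ 3 ^ 3" where
  "jmat = (\<lambda>(z, y, x, \<xi>1, \<xi>2, \<xi>3). vector
     [vector [oreal \<xi>1, z,         oconj y],
      vector [oconj z,  oreal \<xi>2, x],
      vector [y,        oconj x,   oreal \<xi>3]])"

definition omatmult :: "octonion ^ 3 ^ 3 \<Rightarrow> octonion ^ 3 ^ 3 \<Rightarrow> octonion ^ 3 ^ 3" where
  "omatmult M N = (\<chi> i j. \<Sum>k\<in>UNIV. M $ i $ k \<odot> N $ k $ j)"

text \<open>The Jordan product is half of \<open>AB + BA\<close>. That matrix is again of the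
  form \<open>jmat C\<close>, and \<open>jprod\<close> reads off the coordinates of \<open>C\<close>; see \<open>jmat_jprod\<close>.\<close>

definition jprod :: "jordan \<Rightarrow> jordan \<Rightarrow> jordan"  (infixl "\<bullet>\<^sub>J" 70) where
  "A \<bullet>\<^sub>J B = (let M = (1 / 2) *\<^sub>R (omatmult (jmat A) (jmat B) + omatmult (jmat B) (jmat A))
     in (M $ 1 $ 2, M $ 3 $ 1, M $ 2 $ 3, ore (M $ 1 $ 1), ore (M $ 2 $ 2), ore (M $ 3 $ 3)))"

lemma jmat_jprod:
  "jmat (A \<bullet>\<^sub>J B) = (1 / 2) *\<^sub>R (omatmult (jmat A) (jmat B) + omatmult (jmat B) (jmat A))"
proof -
  have oconj_omult: "oconj (u \<odot> v) = oconj v \<odot> oconj u" for u v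
    by (simp add: omult_def oconj_def qmult_def qconj_def split_beta algebra_simps)
  have oconj_simps: "oconj (oconj u) = u" "oconj (u + v) = oconj u + oconj v"
    "oconj (r *\<^sub>R u) = r *\<^sub>R oconj u" for u v r
    by (simp_all add: oconj_def qconj_def split_beta prod_eq_iff complex_eq_iff)
  have real: "oreal (ore u) = u" if "oconj u = u" for u
    using that by (auto simp: oreal_def ore_def oconj_def qconj_def split_beta prod_eq_iff
        complex_eq_iff)
  have herm: "oconj (jmat C $ i $ j) = jmat C $ j $ i" for C i j
    using exhaust_3[of i] exhaust_3[of j]
    by (auto simp: jmat_def oconj_simps split_beta) (auto simp: oconj_def qconj_def oreal_def)
  define M where
    "M = (1 / 2) *\<^sub>R (omatmult (jmat A) (jmat B) + omatmult (jmat B) (jmat A))"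
  have M: "oconj (M $ i $ j) = M $ j $ i" for i j
    by (simp add: M_def omatmult_def sum_3 oconj_simps oconj_omult herm algebra_simps)
  show ?thesis
    unfolding jprod_def M_def[symmetric] Let_def
    by (simp add: jmat_def vec_eq_iff forall_3 M real)
qed

definition jid :: jordan where
  "jid = (0, 0, 0, 1, 1, 1)"

definition jtrace :: "jordan \<Rightarrow> real" where
  "jtrace = (\<lambda>(z, y, x, \<xi>1, \<xi>2, \<xi>3). \<xi>1 + \<xi>2 + \<xi>3)"

definition F4 :: "(jordan \<Rightarrow> jordan) set" where
  "F4 = {g. linear g \<and> bij g \<and> (\<forall>A B. g (A \<bullet>\<^sub>J B) = g A \<bullet>\<^sub>J g B) \<and> g jid = jid}"

definition P2O :: "jordan set" where
  "P2O = {X. omatmult (jmat X) (jmat X) = jmat X \<and> jtrace X = 1}"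


section \<open>Polynomials, invariants and Cayley harmonics\<close>

text \<open>A polynomial maps exponents \<open>\<alpha>\<close> to complex coefficients; variable \<open>i \<in> {1..27}\<close> stands for
  the coordinate \<open>s\<^sub>i\<close>.\<close>

type_synonym cpoly = "(nat \<Rightarrow>\<^sub>0 nat) \<Rightarrow>\<^sub>0 complex"

definition jcoord :: "nat \<Rightarrow> jordan \<Rightarrow> real" where
  "jcoord i = (\<lambda>(z, y, x, \<xi>1, \<xi>2, \<xi>3).
     (ocoords z @ ocoords y @ ocoords x @ [\<xi>1, \<xi>2, \<xi>3]) ! (i - 1))"

definition peval :: "cpoly \<Rightarrow> jordan \<Rightarrow> complex" where
  "peval Q A = (\<Sum>\<alpha>\<in>Poly_Mapping.keys Q. Poly_Mapping.lookup Q \<alpha> *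
     (\<Prod>i=1..27. complex_of_real (jcoord i A) ^ Poly_Mapping.lookup \<alpha> i))"

definition cscale :: "complex \<Rightarrow> cpoly \<Rightarrow> cpoly" where
  "cscale c Q = Poly_Mapping.single 0 c * Q"

global_interpretation cpoly: vector_space cscale
  defines cpoly_span = cpoly.span
  by unfold_locales
    (simp_all add: cscale_def algebra_simps single_add mult_single flip: mult.assoc)

definition hompoly :: "nat \<Rightarrow> cpoly set" where
  "hompoly k = {Q. \<forall>\<alpha>\<in>Poly_Mapping.keys Q.
     Poly_Mapping.keys \<alpha> \<subseteq> {1..27} \<and> (\<Sum>i=1..27. Poly_Mapping.lookup \<alpha> i) = k}"

definition allpoly :: "cpoly set" where
  "allpoly = cpoly_span (\<Union>k. hompoly k)"

definition pinner :: "cpoly \<Rightarrow> cpoly \<Rightarrow> complex" where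
  "pinner Q R = (\<Sum>\<alpha>\<in>Poly_Mapping.keys Q \<union> Poly_Mapping.keys R.
     (\<Prod>i=1..27. fact (Poly_Mapping.lookup \<alpha> i)) *
     Poly_Mapping.lookup Q \<alpha> * cnj (Poly_Mapping.lookup R \<alpha>))"

text \<open>Polynomials over the infinite field of real numbers are determined by their values, so
  invariance is expressed through the polynomial functions.\<close>

definition invpoly :: "nat \<Rightarrow> cpoly set" where
  "invpoly k = {Q \<in> hompoly k. \<forall>g\<in>F4. peval Q \<circ> inv g = peval Q}"

definition span_products :: "cpoly set \<Rightarrow> cpoly set \<Rightarrow> cpoly set" where
  "span_products S T = cpoly_span {p * q | p q. p \<in> S \<and> q \<in> T}"

text \<open>The sum of finitely many subspaces is the span of their union.\<close>

fun harmonic :: "nat \<Rightarrow> cpoly set" where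
  "harmonic k = (if k = 0 then hompoly 0 else
     {Q \<in> hompoly k. \<forall>R \<in> cpoly_span (\<Union>i\<in>{..<k}. span_products (harmonic i) (invpoly (k - i))).
        pinner Q R = 0})"

declare harmonic.simps [simp del]


section \<open>Smooth functions on subsets of Euclidean space and the smooth topology\<close>

text \<open>Iterated directional derivatives along a list of vectors; the last one is applied first.\<close>

primrec iter_deriv :: "'a list \<Rightarrow> ('a::real_normed_vector \<Rightarrow> 'b::real_normed_vector) \<Rightarrow> 'a \<Rightarrow> 'b"
  where
    "iter_deriv [] f = f"
  | "iter_deriv (v # vs) f = (\<lambda>x. frechet_derivative (iter_deriv vs f) (at x) v)"

definition smooth_on_open ::
    "'a::real_normed_vector set \<Rightarrow> ('a \<Rightarrow> 'b::real_normed_vector) \<Rightarrow> bool" where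
  "smooth_on_open U f \<longleftrightarrow> open U \<and> (\<forall>vs. iter_deriv vs f differentiable_on U)"

text \<open>Smoothness on an arbitrary subset: local extendability to smooth maps on open sets. On an
  embedded submanifold this is the usual notion.\<close>

definition smooth_on_set ::
    "'a::real_normed_vector set \<Rightarrow> ('a \<Rightarrow> 'b::real_normed_vector) \<Rightarrow> bool" where
  "smooth_on_set M f \<longleftrightarrow>
     (\<forall>x\<in>M. \<exists>W F. x \<in> W \<and> smooth_on_open W F \<and> (\<forall>y\<in>M \<inter> W. F y = f y))"

definition Cinf :: "'a::real_normed_vector set \<Rightarrow> ('a \<Rightarrow> complex) set" where
  "Cinf M = {f \<in> extensional M. smooth_on_set M f}"

text \<open>Local parametrizations (inverses of charts) of \<open>M\<close>: diffeomorphisms from an open subset of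
  the model space onto a relatively open subset of \<open>M\<close>.\<close>

definition local_param ::
    "'a::real_normed_vector set \<Rightarrow> 'd::real_normed_vector set \<Rightarrow> ('d \<Rightarrow> 'a) \<Rightarrow> bool" where
  "local_param M U \<phi> \<longleftrightarrow> smooth_on_open U \<phi> \<and> inj_on \<phi> U \<and>
     openin (top_of_set M) (\<phi> ` U) \<and> smooth_on_set (\<phi> ` U) (the_inv_into U \<phi>)"

text \<open>The topology of uniform convergence of all partial derivatives on compact subsets of
  charts. The first argument fixes the dimension \<open>CARD('d)\<close> of the manifold \<open>M\<close>.\<close>

definition Cinf_topology ::
    "'d::finite itself \<Rightarrow> 'a::real_normed_vector set \<Rightarrow> ('a \<Rightarrow> complex) topology" where
  "Cinf_topology _ M = topology_generated_by
     {{g \<in> Cinf M. \<forall>u\<in>K. norm (iter_deriv vs (\<lambda>w. g (\<phi> w) - f (\<phi> w)) u) < e}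
      | f U \<phi> K vs e. f \<in> Cinf M \<and> local_param M (U :: (real ^ 'd) set) \<phi> \<and>
          compact K \<and> K \<subseteq> U \<and> set vs \<subseteq> Basis \<and> 0 < e}"

text \<open>Restrictions of polynomial functions to the projective plane, and the algebraic sum of
  countably many spaces of functions on it (only finite sums of elements).\<close>

definition restr :: "cpoly \<Rightarrow> jordan \<Rightarrow> complex" where
  "restr Q = restrict (peval Q) P2O"

definition sum_spaces :: "(nat \<Rightarrow> (jordan \<Rightarrow> complex) set) \<Rightarrow> (jordan \<Rightarrow> complex) set" where
  "sum_spaces V = {(\<lambda>X\<in>P2O. \<Sum>k<n. f k X) | n f. \<forall>k<n. f k \<in> V k}"

end

theory Submission
  imports Defs
begin

text \<open>Moufang's identities and real rotations yield enough elements of \<open>F4\<close> to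
    diagonalise every
  element of the projective plane, so invariant polynomials are constant there, and the
  decomposition of homogeneous polynomials is an orthogonal projection.

  For the density, a neighbourhood in the smooth topology involves only finitely many derivatives.
  A smooth function on the compact projective plane is extended to a compactly supported
      \<open>C\<^sup>k\<close>
  function \<open>F\<close>, and \<open>F\<close> is convolved with a polynomial \<open>q\<close> that
      is uniformly close to a continuous
  approximate identity.  All derivatives fall on \<open>F\<close>,
      so the convolution is close to \<open>F\<close> together
  with its derivatives, while near the support of \<open>F\<close> it is a polynomial because
      \<open>q\<close> is one.\<close>

section \<open>Octonion identities\<close>

text \<open>Matrices over the octonions do not associate, so conjugation by an octonionic matrix
  need not respect the Jordan product. Real matrices associate with everything, which is why real
  rotations work. The only octonionic freedom required is to make one off-diagonal entry real: left
  multiplication by a unit octonion does this, provided the other two entries are moved by the maps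
  that Moufang's identities dictate.

  Uniform approximation of a function by polynomials says nothing about its derivatives; hence
  Stone-Weierstrass is applied to the convolution kernel instead of the function. The topology is
  described in charts of \<open>P2O\<close>, while polynomials live on the ambient space of
  dimension 27. The bridge is a bound of chart derivatives of a composition by ambient derivatives,
  with a constant that does not depend on the function.\<close>

lemma moufang_LR: "(u \<odot> x) \<odot> (y \<odot> u) = u \<odot> (x \<odot> y) \<odot> u"
  by (simp add: omult_def qmult_def qconj_def split_beta prod_eq_iff algebra_simps)

lemma of_real_inner_self_complex: "complex_of_real (a \<bullet> a) = a * cnj a"
  by (simp add: complex_eq_iff inner_complex_def)

text \<open>Writing the squared norm through \<open>cnj\<close> keeps the Moufang identities inside
  a commutative ring, in the four complex components and their conjugates, where
  \<open>algebra_simps\<close> settles them.\<close>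

lemma of_real_inner_self_octonion:
  "complex_of_real (((a, b), (c, d)) \<bullet> ((a, b), (c, d))) =
      a * cnj a + b * cnj b + c * cnj c + d * cnj d"
  by (simp add: inner_prod_def of_real_inner_self_complex)

text \<open>For a unit \<open>u\<close> this is the Moufang identity (y u)(u^-1 z u^-1) = (y z)
  u^-1; the factor \<open>u \<bullet> u\<close> clears the inverses. It governs the \<open>x\<close>
  entry of a product under \<open>jmoufang\<close>.\<close>

lemma moufang_R: "(y \<odot> u) \<odot> (oconj u \<odot> z \<odot> oconj u) =
    (u \<bullet> u) *\<^sub>R ((y \<odot> z) \<odot> oconj u)"
proof -
  obtain u1 u2 u3 u4 where u: "u = ((u1, u2), (u3, u4))" by (metis surj_pair)
  obtain y1 y2 y3 y4 where y: "y = ((y1, y2), (y3, y4))" by (metis surj_pair)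
  obtain z1 z2 z3 z4 where z: "z = ((z1, z2), (z3, z4))" by (metis surj_pair)
  show ?thesis unfolding u y z
   by (simp add: omult_def oconj_def qmult_def qconj_def scaleR_conv_of_real 
     of_real_inner_self_octonion del: inner_Pair) (simp add: algebra_simps)
qed

text \<open>The mirror image of \<open>moufang_R\<close>, for the \<open>y\<close> entry.\<close>

lemma moufang_L: "(oconj u \<odot> z \<odot> oconj u) \<odot> (u \<odot> x) =
    (u \<bullet> u) *\<^sub>R (oconj u \<odot> (z \<odot> x))"
proof -
  obtain u1 u2 u3 u4 where u: "u = ((u1, u2), (u3, u4))" by (metis surj_pair)
  obtain x1 x2 x3 x4 where x: "x = ((x1, x2), (x3, x4))" by (metis surj_pair)
  obtain z1 z2 z3 z4 where z: "z = ((z1, z2), (z3, z4))" by (metis surj_pair)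
  show ?thesis unfolding u x z
   by (simp add: omult_def oconj_def qmult_def qconj_def scaleR_conv_of_real 
     of_real_inner_self_octonion del: inner_Pair) (simp add: algebra_simps)
qed

text \<open>On the diagonal the symmetrised product retains only real parts, that is, inner
  products; off the diagonal each entry receives conjugated products of the other two. Maps that are
  not given by matrices can be checked on this form.\<close>

lemma jprod_eq:
  "(z, y, x, a, b, c) \<bullet>\<^sub>J (z', y', x', a', b', c') =
    ((1/2) *\<^sub>R ((a + b) *\<^sub>R z' + (a' + b') *\<^sub>R z + oconj (x \<odot> y') + oconj
        (x' \<odot> y)),
     (1/2) *\<^sub>R ((a + c) *\<^sub>R y' + (a' + c') *\<^sub>R y + oconj (z \<odot> x') + oconj
         (z' \<odot> x)),
     (1/2) *\<^sub>R ((b + c) *\<^sub>R x' + (b' + c') *\<^sub>R x + oconj (y \<odot> z') + oconj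
         (y' \<odot> z)),
     a * a' + z \<bullet> z' + y \<bullet> y', b * b' + z \<bullet> z' + x \<bullet> x',
         c * c' + y \<bullet> y' + x \<bullet> x')"
  by (simp add: jprod_def jmat_def omatmult_def sum_3 omult_def oconj_def qmult_def qconj_def
     oreal_def ore_def split_beta prod_eq_iff complex_eq_iff inner_complex_def inner_prod_def Let_def
         algebra_simps)

section \<open>Transitivity on the projective plane\<close>

lemma oconj_simps [simp]:
  "oconj (oconj u) = u" "oconj 0 = 0" "oconj (- u) = - oconj u"
  by (simp_all add: oconj_def qconj_def split_beta prod_eq_iff)

lemma oconj_add: "oconj (u + v) = oconj u + oconj v"
  and oconj_scaleR: "oconj (r *\<^sub>R u) = r *\<^sub>R oconj u"
  and oconj_omult: "oconj (u \<odot> v) = oconj v \<odot> oconj u"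
  by (simp_all add: oconj_def qconj_def omult_def qmult_def split_beta prod_eq_iff complex_eq_iff algebra_simps)

lemma bilinear_omult: "bilinear (\<odot>)"
  unfolding bilinear_def
  by (auto intro!: linearI simp: omult_def qconj_def qmult_def split_beta prod_eq_iff complex_eq_iff
      algebra_simps)

lemmas omult_bilinear_simps =
  bilinear_ladd[OF bilinear_omult] bilinear_radd[OF bilinear_omult]
  bilinear_lmul[OF bilinear_omult] bilinear_rmul[OF bilinear_omult]

lemma inner_oconj_oconj: "oconj x \<bullet> oconj y = x \<bullet> y"
  by (simp add: oconj_def qconj_def split_beta inner_prod_def inner_complex_def)

lemma omult_oconj_self: "oconj u \<odot> u = oreal (u \<bullet> u)"
  by (simp add: oconj_def qconj_def omult_def qmult_def oreal_def split_beta prod_eq_iff complex_eq_iff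
      inner_prod_def inner_complex_def algebra_simps)

text \<open>Two octonions generate an associative algebra, so \<open>u\<close> and
  \<open>oconj u\<close> cancel up to the squared norm.\<close>

lemma omult_oconj_cancel: "oconj u \<odot> (u \<odot> x) =
    (u \<bullet> u) *\<^sub>R x" "u \<odot> (oconj u \<odot> x) = (u \<bullet> u) *\<^sub>R x"
  "(x \<odot> u) \<odot> oconj u = (u \<bullet> u) *\<^sub>R x" "(x \<odot> oconj u) \<odot> u =
      (u \<bullet> u) *\<^sub>R x"
  by (simp_all add: oconj_def qconj_def omult_def qmult_def split_beta prod_eq_iff complex_eq_iff
      inner_prod_def inner_complex_def algebra_simps)

lemma omult_flexible: "(u \<odot> z) \<odot> u = u \<odot> (z \<odot> u)"
  by (simp_all add: oconj_def qconj_def omult_def qmult_def split_beta prod_eq_iff algebra_simps)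

lemma ore_oconj_omult: "ore (oconj x \<odot> y) = x \<bullet> y" "ore (x \<odot> oconj y) = x \<bullet> y"
  by (simp_all add: ore_def oconj_def qconj_def omult_def qmult_def split_beta inner_prod_def inner_complex_def)

text \<open>The associator is purely imaginary.\<close>

lemma ore_assoc: "ore ((x \<odot> y) \<odot> z) = ore (x \<odot> (y \<odot> z))"
  by (simp add: ore_def omult_def qmult_def qconj_def split_beta algebra_simps)

lemma ore_scaleR: "ore (r *\<^sub>R x) = r * ore x"
  by (simp add: ore_def)

text \<open>Multiplicativity of the norm, polarised: rebracketing under the real part produces
  \<open>oconj u \<odot> (u \<odot> y)\<close>, which cancels.\<close>

lemma inner_omult_left: "(u \<odot> x) \<bullet> (u \<odot> y) = (u \<bullet> u) * (x \<bullet> y)"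
  by (simp add: oconj_omult ore_assoc omult_oconj_cancel omult_bilinear_simps ore_scaleR
      flip: ore_oconj_omult(1))

lemma inner_omult_right: "(x \<odot> u) \<bullet> (y \<odot> u) = (u \<bullet> u) * (x \<bullet> y)"
  by (simp add: oconj_omult omult_oconj_cancel omult_bilinear_simps ore_scaleR
      flip: ore_oconj_omult(2) ore_assoc)

section \<open>Conjugation by real orthogonal matrices\<close>

definition jread :: "octonion ^ 3 ^ 3 \<Rightarrow> jordan" where
  "jread M = (M $ 1 $ 2, M $ 3 $ 1, M $ 2 $ 3, ore (M $ 1 $ 1), ore (M $ 2 $ 2), ore (M $ 3 $ 3))"

lemma jprod_jread:
  "A \<bullet>\<^sub>J B = jread ((1 / 2) *\<^sub>R (omatmult (jmat A) (jmat B) + omatmult (jmat B) (jmat A)))"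
  by (simp add: jprod_def jread_def Let_def)

lemma jread_jmat [simp]: "jread (jmat A) = A"
  by (simp add: jread_def jmat_def ore_def oreal_def split_beta)

lemma oconj_jmat: "oconj (jmat A $ i $ j) = jmat A $ j $ i"
  using exhaust_3[of i] exhaust_3[of j]
  by (auto simp: jmat_def split_beta) (auto simp: oconj_def qconj_def oreal_def)

lemma jmat_jread:
  assumes "\<And>i j. oconj (M $ i $ j) = M $ j $ i"
  shows "jmat (jread M) = M"
proof -
  have "oreal (ore u) = u" if "oconj u = u" for u
    using that by (auto simp: oreal_def ore_def oconj_def qconj_def split_beta prod_eq_iff complex_eq_iff)
  then show ?thesis
    by (simp add: jmat_def jread_def vec_eq_iff forall_3 assms)
qed

text \<open>\<open>X \<bullet>\<^sub>J X\<close> is the matrix square, so idempotency can be phrased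
  in the Jordan product, which elements of \<open>F4\<close> preserve.\<close>

lemma mem_P2O_iff: "X \<in> P2O \<longleftrightarrow> X \<bullet>\<^sub>J X = X \<and> jtrace X = 1"
proof -
  have "jmat (X \<bullet>\<^sub>J X) = omatmult (jmat X) (jmat X)"
    by (simp add: jmat_jprod scaleR_2[symmetric])
  then show ?thesis
    unfolding P2O_def by (metis (mono_tags, lifting) jread_jmat mem_Collect_eq)
qed

text \<open>Real scalars commute and associate with octonions. Separate operations for a real factor
  single out triple products that may be rebracketed freely.\<close>

definition lmul_real :: "real ^ 3 ^ 3 \<Rightarrow> octonion ^ 3 ^ 3 \<Rightarrow> octonion ^ 3 ^ 3" where
  "lmul_real R M = (\<chi> i j. \<Sum>k\<in>UNIV. R $ i $ k *\<^sub>R M $ k $ j)"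

definition rmul_real :: "octonion ^ 3 ^ 3 \<Rightarrow> real ^ 3 ^ 3 \<Rightarrow> octonion ^ 3 ^ 3" where
  "rmul_real M R = (\<chi> i j. \<Sum>k\<in>UNIV. R $ k $ j *\<^sub>R M $ i $ k)"

lemma real_mul_assoc:
  "omatmult (lmul_real R M) N = lmul_real R (omatmult M N)"
  "omatmult M (rmul_real N R) = rmul_real (omatmult M N) R"
  "omatmult (rmul_real M R) N = omatmult M (lmul_real R N)"
  "lmul_real R (lmul_real S M) = lmul_real (R ** S) M"
  "rmul_real (lmul_real R M) S = lmul_real R (rmul_real M S)"
  "rmul_real (rmul_real M R) S = rmul_real M (R ** S)"
  "lmul_real (mat 1) M = M" "rmul_real M (mat 1) = M"
  by (simp_all add: omatmult_def lmul_real_def rmul_real_def vec_eq_iff forall_3 sum_3 omult_bilinear_simps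
      matrix_matrix_mult_def mat_def algebra_simps)

lemma real_mul_linear:
  "lmul_real R (M + N) = lmul_real R M + lmul_real R N"
  "rmul_real (M + N) R = rmul_real M R + rmul_real N R"
  "lmul_real R (c *\<^sub>R M) = c *\<^sub>R lmul_real R M"
  "rmul_real (c *\<^sub>R M) R = c *\<^sub>R rmul_real M R"
  by (simp_all add: lmul_real_def rmul_real_def vec_eq_iff forall_3 sum_3 algebra_simps)

definition jrot :: "real ^ 3 ^ 3 \<Rightarrow> jordan \<Rightarrow> jordan" where
  "jrot R A = jread (lmul_real R (rmul_real (jmat A) (transpose R)))"

lemma jmat_jrot: "jmat (jrot R A) = lmul_real R (rmul_real (jmat A) (transpose R))"
  unfolding jrot_def
  by (rule jmat_jread)
    (simp add: lmul_real_def rmul_real_def sum_3 transpose_def oconj_add oconj_scaleR oconj_jmat algebra_simps)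

lemma jread_linear: "linear jread"
  by (rule linearI) (simp_all add: jread_def ore_def)

lemma jmat_linear: "linear jmat"
  by (rule linearI) (simp_all add: jmat_def oreal_def oconj_add oconj_scaleR vec_eq_iff forall_3 split_beta
     prod_eq_iff oconj_def qconj_def scaleR_conv_of_real)

lemma jrot_jrot: "jrot R (jrot S A) = jrot (R ** S) A"
proof -
  have "jmat (jrot R (jrot S A)) = jmat (jrot (R ** S) A)"
    by (simp add: jmat_jrot real_mul_assoc matrix_transpose_mul)
  then show ?thesis by (metis jread_jmat)
qed

lemma F4I:
  assumes "linear g" "\<And>A. h (g A) = A" "\<And>A. g (h A) = A"
    and "\<And>A B. g (A \<bullet>\<^sub>J B) = g A \<bullet>\<^sub>J g B" "g jid = jid"
  shows "g \<in> F4"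
proof -
  have "bij g" by (rule bij_betw_byWitness[of _ h]) (use assms in auto)
  then show ?thesis using assms by (simp add: F4_def)
qed

lemma F4_id: "id \<in> F4"
  by (rule F4I[of _ id]) (auto simp: id_def intro: linearI)

lemma jrot_mat_1: "jrot (mat 1) A = A"
  by (simp add: jrot_def real_mul_assoc transpose_mat)

lemma jrot_F4:
  assumes "orthogonal_matrix R" shows "jrot R \<in> F4"
proof (rule F4I[where h = "jrot (transpose R)"])
  have R: "transpose R ** R = mat 1" "R ** transpose R = mat 1"
    using assms by (auto simp: orthogonal_matrix_def)
  show "linear (jrot R)"
    by (rule linearI) (simp_all add: jrot_def linear_add[OF jmat_linear] linear_add[OF jread_linear]
        real_mul_linear
       linear_cmul[OF jmat_linear] linear_cmul[OF jread_linear])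
  show "jrot (transpose R) (jrot R A) = A" "jrot R (jrot (transpose R) A) = A" for A
    by (simp_all add: jrot_jrot R jrot_mat_1)
  \<comment> \<open>The inner factors \<open>transpose R ** R\<close> cancel, so conjugation
    respects even the matrix product.\<close>
  have mult: "omatmult (jmat (jrot R A)) (jmat (jrot R B)) =
      lmul_real R (rmul_real (omatmult (jmat A) (jmat B)) (transpose R))" for A B
    by (simp add: jmat_jrot real_mul_assoc R)
  show "jrot R (A \<bullet>\<^sub>J B) = jrot R A \<bullet>\<^sub>J jrot R B" for A B
  proof -
    have "jmat (jrot R (A \<bullet>\<^sub>J B)) = jmat (jrot R A \<bullet>\<^sub>J jrot R B)"
      unfolding jmat_jprod mult by (simp add: jmat_jrot jmat_jprod real_mul_linear)
    then show ?thesis by (metis jread_jmat)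
  qed
  have "jmat jid = (\<chi> i j. if i = j then oreal 1 else 0)"
    by (simp add: jmat_def jid_def vec_eq_iff forall_3)
  then have "lmul_real R (rmul_real (jmat jid) (transpose R)) =
      (\<chi> i j. ((R ** transpose R) $ i $ j) *\<^sub>R oreal 1)"
    by (simp add: lmul_real_def rmul_real_def matrix_matrix_mult_def vec_eq_iff forall_3 sum_3 algebra_simps)
  then show "jrot R jid = jid"
    by (simp add: jrot_def R mat_def jid_def jread_def ore_def oreal_def zero_prod_def)
qed

section \<open>Automorphisms from Moufang's identities and cyclic shifts\<close>

definition jmoufang :: "octonion \<Rightarrow> jordan \<Rightarrow> jordan" where
  "jmoufang u = (\<lambda>(z, y, x, \<xi>). (oconj u \<odot> z \<odot> oconj u, y \<odot> u,
      u \<odot> x, \<xi>))"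

lemma inner_oconj_self: "oconj u \<bullet> oconj u = u \<bullet> u"
  by (simp add: inner_oconj_oconj)

lemma norm_oconj [simp]: "norm (oconj u) = norm u"
  by (simp add: norm_eq_sqrt_inner inner_oconj_oconj)

text \<open>Facts 1 to 3 treat the products landing in the entries \<open>z\<close>,
  \<open>x\<close> and \<open>y\<close>: by the Moufang identities each transforms by the same map
  as the entry itself. The diagonal involves only inner products, which a unit octonion
  preserves.\<close>

lemma jmoufang_F4:
  assumes u: "u \<bullet> u = 1" shows "jmoufang u \<in> F4"
proof (rule F4I[where h = "jmoufang (oconj u)"])
  note cancel = omult_oconj_cancel[where u = u, unfolded u scaleR_one]
  show "linear (jmoufang u)"
    by (rule linearI) (simp_all add: jmoufang_def omult_bilinear_simps split_beta)
  show "jmoufang (oconj u) (jmoufang u A) = A" for A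
    by (simp add: jmoufang_def split_beta omult_flexible[of "oconj u"] cancel)
  show "jmoufang u (jmoufang (oconj u) A) = A" for A
    by (simp add: jmoufang_def split_beta omult_flexible[of "u"] cancel)
  show "jmoufang u jid = jid"
    using bilinear_rzero[OF bilinear_omult] bilinear_lzero[OF bilinear_omult]
    by (simp add: jmoufang_def jid_def)
  show "jmoufang u (A \<bullet>\<^sub>J B) = jmoufang u A \<bullet>\<^sub>J jmoufang u B" for A B
  proof -
    obtain z y x a b c where A: "A = (z, y, x, a, b, c)" by (metis surj_pair)
    obtain z' y' x' a' b' c' where B: "B = (z', y', x', a', b', c')" by (metis surj_pair)
    have 1: "oconj ((u \<odot> x) \<odot> (y \<odot> u)) =
        (oconj u \<odot> oconj (x \<odot> y)) \<odot> oconj u" for x y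
      unfolding moufang_LR by (simp add: oconj_omult flip: omult_flexible[of "oconj u"])
    have 2: "oconj ((y \<odot> u) \<odot> (oconj u \<odot> z \<odot> oconj u)) =
        u \<odot> oconj (y \<odot> z)" for y z
      by (simp add: moufang_R u) (simp add: oconj_omult)
    have 3: "oconj ((oconj u \<odot> z \<odot> oconj u) \<odot> (u \<odot> x)) =
        oconj (z \<odot> x) \<odot> u" for x z
      by (simp add: moufang_L u) (simp add: oconj_omult)
    show ?thesis
      by (simp add: A B jmoufang_def jprod_eq 1 2 3 omult_bilinear_simps
          inner_omult_left inner_omult_right inner_oconj_self u)
  qed
qed

text \<open>Conjugation by a cyclic permutation matrix, in coordinates. The positions (1,2), (3,1),
  (2,3) permute among themselves, so no conjugate appears.\<close>

definition jcyc :: "jordan \<Rightarrow> jordan" where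
  "jcyc = (\<lambda>(z, y, x, a, b, c). (y, x, z, c, a, b))"

lemma jcyc_F4: "jcyc \<in> F4"
proof (rule F4I[where h = "jcyc \<circ> jcyc"])
  show "linear jcyc" by (rule linearI) (simp_all add: jcyc_def split_beta)
  show "jcyc (A \<bullet>\<^sub>J B) = jcyc A \<bullet>\<^sub>J jcyc B" for A B
  proof -
    obtain z y x a b c where A: "A = (z, y, x, a, b, c)" by (metis surj_pair)
    obtain z' y' x' a' b' c' where B: "B = (z', y', x', a', b', c')" by (metis surj_pair)
    show ?thesis by (simp add: A B jcyc_def jprod_eq algebra_simps)
  qed
qed (simp_all add: jcyc_def jid_def split_beta)

definition rot23 :: "real \<Rightarrow> real \<Rightarrow> real ^ 3 ^ 3" where
  "rot23 c s = vector [vector [1, 0, 0], vector [0, c, - s], vector [0, s, c]]"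

lemma orthogonal_rot23: "c\<^sup>2 + s\<^sup>2 = 1 \<Longrightarrow> orthogonal_matrix (rot23 c s)"
  by (simp add: orthogonal_matrix_def rot23_def matrix_matrix_mult_def transpose_def mat_def vec_eq_iff
      forall_3 sum_3
      power2_eq_square algebra_simps)

lemma jrot_rot23:
  "jrot (rot23 c s) (z, y, x, a, b, d) =
    (c *\<^sub>R z - s *\<^sub>R oconj y, s *\<^sub>R oconj z + c *\<^sub>R y,
     (c * s * (b - d)) *\<^sub>R oreal 1 + c\<^sup>2 *\<^sub>R x - s\<^sup>2 *\<^sub>R oconj x,
     a, c\<^sup>2 * b - 2 * c * s * ore x + s\<^sup>2 * d, s\<^sup>2 * b + 2 * c * s * ore x + c\<^sup>2 * d)"
  by (simp add: jrot_def jread_def lmul_real_def rmul_real_def rot23_def transpose_def jmat_def sum_3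
     prod_eq_iff complex_eq_iff oreal_def ore_def oconj_def qconj_def split_beta power2_eq_square algebra_simps)

lemma F4_jprod: "g \<in> F4 \<Longrightarrow> g (A \<bullet>\<^sub>J B) = g A \<bullet>\<^sub>J g B"
  unfolding F4_def by blast

lemma F4_comp: assumes "g \<in> F4" "h \<in> F4" shows "g \<circ> h \<in> F4"
proof -
  have "(g \<circ> h) (A \<bullet>\<^sub>J B) = (g \<circ> h) A \<bullet>\<^sub>J (g \<circ> h) B" for A B
    unfolding comp_apply F4_jprod[OF assms(1)] F4_jprod[OF assms(2)] ..
  moreover have "linear (g \<circ> h)" "bij (g \<circ> h)" "(g \<circ> h) jid = jid"
    using assms by (auto simp only: F4_def mem_Collect_eq comp_apply intro: linear_compose bij_comp)
  ultimately show ?thesis unfolding F4_def by blast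
qed

text \<open>The principal 2 by 2 minors vanish, as for a matrix of rank one; the diagonal of the
  idempotency equation and the trace already imply this.\<close>

lemma P2O_relations:
  assumes "(z, y, x, a, b, c) \<in> P2O"
  shows "a + b + c = 1" "b * c = x \<bullet> x" "a * c = y \<bullet> y" "a * b =
      z \<bullet> z" "0 \<le> a" "0 \<le> b" "0 \<le> c"
proof -
  have tr: "a + b + c = 1" 
    and eq: "a * a + z \<bullet> z + y \<bullet> y = a" "b * b + z \<bullet> z + x \<bullet> x =
        b" "c * c + y \<bullet> y + x \<bullet> x = c"
    using assms by (simp_all add: mem_P2O_iff jprod_eq jtrace_def)
  show "a + b + c = 1" by fact
  have "a = 1 - b - c" using tr by simp
  show "0 \<le> a" "0 \<le> b" "0 \<le> c"
    using eq by (smt (verit) inner_ge_zero zero_le_square)+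
  \<comment> \<open>With \<open>eq\<close> this says that \<open>a * b + a * c\<close> is the sum of
    the squared norms of \<open>z\<close> and \<open>y\<close>, and two analogues: a linear system
    solved by the three minors.\<close>
  have "a * (a + b + c) = a" "b * (a + b + c) = b" "c * (a + b + c) = c"
    by (simp_all add: tr)
  then show "b * c = x \<bullet> x" "a * c = y \<bullet> y" "a * b = z \<bullet> z"
    using eq by (simp_all add: algebra_simps)
qed

text \<open>Idempotency is a Jordan identity and transfers along \<open>g\<close>; the trace is read
  off the explicit images wherever this is applied.\<close>

lemma F4_P2O:
  assumes "g \<in> F4" "X \<in> P2O" "jtrace (g X) = 1" shows "g X \<in> P2O"
  using assms by (simp add: mem_P2O_iff flip: F4_jprod)

text \<open>A unit octonion makes the entry \<open>x\<close> real, and a real rotation then diagonalises the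
  lower right block, which has determinant \<open>0\<close>.\<close>

lemma P2O_diagonalise_block:
  assumes X: "(z, y, x, a, b, c) \<in> P2O"
  shows "\<exists>g\<in>F4. \<exists>y'. g (z, y, x, a, b, c) = (0, y', 0, a, 0, b + c) \<and>
      (0, y', 0, a, 0, b + c) \<in> P2O"
proof -
  note rel = P2O_relations[OF X]
  define t where "t = b + c"
  obtain g z1 y1 where g: "g \<in> F4" "g (z, y, x, a, b, c) = (z1, y1, oreal (norm x), a, b, c)"
  proof (cases "x = 0")
    case True
    then show ?thesis using that[OF F4_id] by (simp add: oreal_def zero_prod_def)
  next
    case False
    define u where "u = (1 / norm x) *\<^sub>R oconj x"
    have "u \<bullet> u = 1" using False by (simp add: u_def inner_oconj_self dot_square_norm power2_eq_square)
    moreover have "u \<odot> x = oreal (norm x)"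
      using False by (simp add: u_def omult_bilinear_simps omult_oconj_self dot_square_norm power2_eq_square)
        (simp add: oreal_def scaleR_conv_of_real)
    ultimately show ?thesis using that[OF jmoufang_F4] by (simp add: jmoufang_def)
  qed
  obtain h where h: "h \<in> F4" "\<exists>z2 y2. h (z1, y1, oreal (norm x), a, b, c) =
      (z2, y2, 0, a, 0, b + c)"
  \<comment> \<open>The rotation divides by \<open>t\<close>. If \<open>t = 0\<close>, nonnegativity
    makes the whole block vanish already.\<close>
  proof (cases "t = 0")
    case True
    then have "b = 0" "c = 0" using rel by (auto simp: t_def)
    moreover have "x = 0" using rel(2) \<open>b = 0\<close> by simp
    ultimately have "id (z1, y1, oreal (norm x), a, b, c) = (z1, y1, 0, a, 0, b + c)"
      by (simp add: oreal_def zero_prod_def)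
    then show ?thesis using that F4_id by blast
  next
    case False
    then have t: "t > 0" using rel by (auto simp: t_def)
    \<comment> \<open>The real block has rank one and is spanned by the vector (sqrt b, sqrt c); the
      rotation with cosine \<open>r\<close> and sine \<open>s\<close> takes that vector to (0, sqrt
      t).\<close>
    define r s where "r = sqrt (c / t)" and "s = sqrt (b / t)"
    have rs: "r\<^sup>2 = c / t" "s\<^sup>2 = b / t" using t rel by (auto simp: r_def s_def)
    have n: "norm x = sqrt (b * c)" unfolding rel by (simp add: norm_eq_sqrt_inner)
    have "r * s = norm x / t"
      using t unfolding n r_def s_def by (simp add: real_sqrt_mult real_sqrt_divide field_simps)
    then have mrs: "r * s = norm x / t" "r * (s * w) = norm x / t * w" for w
      by (simp_all flip: mult.assoc)
    have nn: "norm x * norm x = b * c" unfolding rel by (simp add: dot_square_norm power2_eq_square)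
    have "orthogonal_matrix (rot23 r s)"
      using t by (intro orthogonal_rot23) (simp add: rs t_def add.commute flip: add_divide_distrib)
    moreover have "oconj (oreal w) = oreal w" "ore (oreal w) = w" "w *\<^sub>R oreal 1 =
        oreal w" "w *\<^sub>R oreal v = oreal (w * v)"
       "oreal w + oreal v = oreal (w + v)" "oreal w - oreal v = oreal (w - v)" for w v
      by (simp_all add: oconj_def oreal_def ore_def qconj_def scaleR_conv_of_real zero_prod_def)
    moreover have "r * s * (b - c) + r\<^sup>2 * norm x - s\<^sup>2 * norm x = 0"
      using t by (simp add: rs mrs field_simps)
    moreover have "r\<^sup>2 * b - 2 * r * s * norm x + s\<^sup>2 * c = 0"
      using t by (simp add: rs mrs nn field_simps)
    moreover have "s\<^sup>2 * b + 2 * r * s * norm x + r\<^sup>2 * c = b + c"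
    proof -
      have "s\<^sup>2 * b + 2 * r * s * norm x + r\<^sup>2 * c = (b * b + 2 * (b * c) + c * c) / t"
        using t by (simp add: rs mrs nn field_simps)
      also have "\<dots> = b + c" using t by (simp add: t_def field_simps)
      finally show ?thesis .
    qed
    moreover have "oreal 0 = 0" by (simp add: oreal_def zero_prod_def)
    ultimately have "jrot (rot23 r s) \<in> F4"
      "jrot (rot23 r s) (z1, y1, oreal (norm x), a, b, c) =
        (r *\<^sub>R z1 - s *\<^sub>R oconj y1, s *\<^sub>R oconj z1 + r *\<^sub>R y1, 0, a, 0, b + c)"
      by (simp_all add: jrot_rot23 jrot_F4)
    then show ?thesis using that by blast
  qed
  obtain z2 y2 where h2: "h (z1, y1, oreal (norm x), a, b, c) = (z2, y2, 0, a, 0, b + c)" using h by blast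
  have F: "h \<circ> g \<in> F4" using F4_comp g h by blast
  have eq: "(h \<circ> g) (z, y, x, a, b, c) = (z2, y2, 0, a, 0, b + c)" by (simp add: g h2)
  have P: "(z2, y2, 0, a, 0, b + c) \<in> P2O"
    using F4_P2O[OF F X] rel unfolding eq by (simp add: jtrace_def)
  \<comment> \<open>The second diagonal entry is now 0, and the squared norm of \<open>z2\<close> is
    its product with \<open>a\<close>.\<close>
  then have "z2 = 0" using P2O_relations[OF P] by simp
  then show ?thesis using F eq P by blast
qed

text \<open>One diagonalisation leaves a single off-diagonal entry. Two cyclic shifts bring it into
  the lower right block, where a second diagonalisation removes it; the first diagonal entry is then
  0, which kills the remaining octonion.\<close>

lemma P2O_orbit: assumes "X \<in> P2O" shows "\<exists>g\<in>F4. g X = (0, 0, 0, 0, 0, 1)"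
proof -
  obtain z y x a b c where X: "X = (z, y, x, a, b, c)" by (metis surj_pair)
  obtain g y1 where g: "g \<in> F4" "g X = (0, y1, 0, a, 0, b + c)" "g X \<in> P2O"
    using P2O_diagonalise_block assms unfolding X by metis
  have j: "jcyc (g X) = (y1, 0, 0, b + c, a, 0)" by (simp add: g jcyc_def)
  have j2: "jcyc (jcyc (g X)) = (0, 0, y1, 0, b + c, a)" by (simp add: g jcyc_def)
  have s: "a + b + c = 1" using P2O_relations(1) assms unfolding X by blast
  have "jcyc (jcyc (g X)) \<in> P2O"
  proof -
    have "jtrace (jcyc (g X)) = 1" "jtrace (jcyc (jcyc (g X))) = 1"
      unfolding j2 unfolding j jtrace_def using s by simp_all
    then show ?thesis by (intro F4_P2O[OF jcyc_F4] g)
  qed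
  then obtain h y' where h: "h \<in> F4" "h (jcyc (jcyc (g X))) =
      (0, y', 0, 0, 0, b + c + a)" "h (jcyc (jcyc (g X))) \<in> P2O"
    using P2O_diagonalise_block unfolding j2 by metis
  then have "y' = 0" using P2O_relations(3) by fastforce
  then have "(h \<circ> (jcyc \<circ> (jcyc \<circ> g))) X = (0, 0, 0, 0, 0, 1)" using h s
      by (simp add: algebra_simps)
  moreover have "h \<circ> (jcyc \<circ> (jcyc \<circ> g)) \<in> F4" by (intro F4_comp h g jcyc_F4)
  ultimately show ?thesis by blast
qed

lemma invpoly_constant_on: assumes "Q \<in> invpoly k" shows "peval Q constant_on P2O"
proof -
  have "peval Q X = peval Q (0, 0, 0, 0, 0, 1)" if X: "X \<in> P2O" for X
  proof -
    obtain g where g: "g \<in> F4" "g X = (0, 0, 0, 0, 0, 1)" using P2O_orbit[OF X] by blast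
    have "inv g (g X) = X" using g unfolding F4_def by (blast intro: inv_f_f bij_is_inj)
    moreover have "(peval Q \<circ> inv g) (g X) = peval Q (g X)" using assms g by (simp add: invpoly_def)
    ultimately show ?thesis by (simp add: g)
  qed
  then show ?thesis unfolding constant_on_def by blast
qed

section \<open>Harmonic decomposition\<close>

definition mono_val :: "(nat \<Rightarrow>\<^sub>0 nat) \<Rightarrow> jordan \<Rightarrow> complex" where
  "mono_val \<alpha> A = (\<Prod>i=1..27. complex_of_real (jcoord i A) ^ Poly_Mapping.lookup \<alpha> i)"

lemma peval_superset:
  assumes "finite S" "Poly_Mapping.keys Q \<subseteq> S"
  shows "peval Q A = (\<Sum>\<alpha>\<in>S. Poly_Mapping.lookup Q \<alpha> * mono_val \<alpha> A)"
  unfolding peval_def mono_val_def using assms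
  by (intro sum.mono_neutral_left) (auto simp: in_keys_iff)

lemma peval_add: "peval (P + Q) A = peval P A + peval Q A"
proof -
  let ?S = "Poly_Mapping.keys P \<union> Poly_Mapping.keys Q"
  have "peval (P + Q) A = (\<Sum>\<alpha>\<in>?S. Poly_Mapping.lookup (P + Q) \<alpha> * mono_val \<alpha> A)"
    by (rule peval_superset) (simp_all add: keys_add)
  also have "\<dots> = peval P A + peval Q A"
    by (simp add: peval_superset[of ?S] lookup_add distrib_right sum.distrib)
  finally show ?thesis .
qed

lemma peval_zero [simp]: "peval 0 A = 0"
  by (simp add: peval_def)

lemma peval_sum: "peval (sum f I) A = (\<Sum>i\<in>I. peval (f i) A)"
  by (induction I rule: infinite_finite_induct) (auto simp: peval_add)

lemma peval_single: "peval (Poly_Mapping.single \<alpha> c) A = c * mono_val \<alpha> A"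
  by (subst peval_superset[of "{\<alpha>}"]) auto

lemma poly_mapping_sum_single:
  "(\<Sum>\<alpha>\<in>Poly_Mapping.keys Q. Poly_Mapping.single \<alpha> (Poly_Mapping.lookup Q \<alpha>)) = Q"
  by (rule poly_mapping_eqI) (simp add: lookup_sum lookup_single when_def in_keys_iff)

lemma mono_val_add: "mono_val (\<alpha> + \<beta>) A = mono_val \<alpha> A * mono_val \<beta> A"
  by (simp add: mono_val_def lookup_add power_add prod.distrib)

lemma peval_mult: "peval (P * Q) A = peval P A * peval Q A"
proof -
  have 1: "peval (Poly_Mapping.single \<alpha> c * Q) A = c * mono_val \<alpha> A * peval Q A" for \<alpha> c
  proof -
    have "Poly_Mapping.single \<alpha> c * Q =
        (\<Sum>\<beta>\<in>Poly_Mapping.keys Q. Poly_Mapping.single (\<alpha> + \<beta>)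
            (c * Poly_Mapping.lookup Q \<beta>))"
      by (subst (1) poly_mapping_sum_single[of Q, symmetric]) (simp add: sum_distrib_left mult_single)
    then show ?thesis
      by (simp add: peval_sum peval_single mono_val_add peval_superset[of "Poly_Mapping.keys Q" Q]
          sum_distrib_left ac_simps)
  qed
  have "P * Q = (\<Sum>\<alpha>\<in>Poly_Mapping.keys P. Poly_Mapping.single \<alpha>
      (Poly_Mapping.lookup P \<alpha>) * Q)"
    by (subst (1) poly_mapping_sum_single[of P, symmetric]) (simp add: sum_distrib_right)
  then show ?thesis
    by (simp add: peval_sum 1 peval_superset[of "Poly_Mapping.keys P" P] sum_distrib_right)
qed

lemma mono_val_zero [simp]: "mono_val 0 A = 1"
  by (simp add: mono_val_def)

lemma peval_cscale: "peval (cscale c Q) A = c * peval Q A"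
  by (simp add: cscale_def peval_mult peval_single)

lemma lookup_cscale: "Poly_Mapping.lookup (cscale c Q) \<alpha> = c * Poly_Mapping.lookup Q \<alpha>"
proof -
  have "cscale c Q = (\<Sum>\<beta>\<in>Poly_Mapping.keys Q. Poly_Mapping.single \<beta>
      (c * Poly_Mapping.lookup Q \<beta>))"
    unfolding cscale_def
    by (subst (1) poly_mapping_sum_single[of Q, symmetric]) (simp add: sum_distrib_left mult_single)
  then show ?thesis
    by (simp add: lookup_sum lookup_single when_def in_keys_iff)
qed

definition hom_exps :: "nat \<Rightarrow> (nat \<Rightarrow>\<^sub>0 nat) set" where
  "hom_exps k = {\<alpha>. Poly_Mapping.keys \<alpha> \<subseteq> {1..27} \<and>
      (\<Sum>i=1..27. Poly_Mapping.lookup \<alpha> i) = k}"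

lemma hompoly_iff: "Q \<in> hompoly k \<longleftrightarrow> Poly_Mapping.keys Q \<subseteq> hom_exps k"
  by (auto simp: hompoly_def hom_exps_def)

text \<open>Each exponent is at most \<open>k\<close> on 27 variables and 0 elsewhere. This makes
  the space of degree \<open>k\<close> finite-dimensional.\<close>

lemma finite_hom_exps: "finite (hom_exps k)"
proof (rule finite_imageD)
  have "Poly_Mapping.lookup \<alpha> i \<le> k" if "\<alpha> \<in> hom_exps k" "i \<in> {1..27}" for \<alpha> i
    using that member_le_sum[of i "{1..27}" "Poly_Mapping.lookup \<alpha>"] by (auto simp: hom_exps_def)
  then have "Poly_Mapping.lookup ` hom_exps k \<subseteq>
      {f. \<forall>x. (x \<in> {1..27} \<longrightarrow> f x \<in> {0..k}) \<and>
          (x \<notin> {1..27} \<longrightarrow> f x = 0)}"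
    by (auto simp: hom_exps_def in_keys_iff)
  then show "finite (Poly_Mapping.lookup ` hom_exps k)"
    by (rule finite_subset) (intro finite_set_of_finite_funs; simp)
qed (auto simp: inj_on_def)

lemma subspace_hompoly: "cpoly.subspace (hompoly k)"
proof -
  have "Q \<in> hompoly k \<longleftrightarrow>
      (\<forall>\<alpha>. \<alpha> \<notin> hom_exps k \<longrightarrow>
      Poly_Mapping.lookup Q \<alpha> = 0)" for Q
    by (auto simp: hompoly_iff in_keys_iff)
  then show ?thesis
    unfolding cpoly.subspace_def by (simp add: lookup_cscale lookup_add)
qed

lemma hompoly_span:
  "hompoly k \<subseteq> cpoly_span ((\<lambda>\<alpha>. Poly_Mapping.single \<alpha> 1) ` hom_exps k)"
proof
  fix Q assume Q: "Q \<in> hompoly k"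
  have "Q = (\<Sum>\<alpha>\<in>Poly_Mapping.keys Q. cscale (Poly_Mapping.lookup Q \<alpha>)
      (Poly_Mapping.single \<alpha> 1))"
    by (subst (1) poly_mapping_sum_single[of Q, symmetric]) (simp add: cscale_def mult_single)
  also have "\<dots> \<in> cpoly_span ((\<lambda>\<alpha>. Poly_Mapping.single \<alpha> 1) ` hom_exps k)"
    using Q by (intro cpoly.span_sum cpoly.span_scale cpoly.span_base) (auto simp: hompoly_iff)
  finally show "Q \<in> cpoly_span ((\<lambda>\<alpha>. Poly_Mapping.single \<alpha> 1) ` hom_exps k)" .
qed

lemma hompoly_mult:
  assumes "P \<in> hompoly i" "Q \<in> hompoly j" shows "P * Q \<in> hompoly (i + j)"
  unfolding hompoly_iff
proof
  fix \<gamma> assume "\<gamma> \<in> Poly_Mapping.keys (P * Q)"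
  then obtain \<alpha> \<beta> where "\<gamma> =
      \<alpha> + \<beta>" "\<alpha> \<in> hom_exps i" "\<beta> \<in> hom_exps j"
    using keys_mult[of P Q] assms unfolding hompoly_iff by blast
  then show "\<gamma> \<in> hom_exps (i + j)"
    using keys_add[of \<alpha> \<beta>] by (auto simp: hom_exps_def lookup_add sum.distrib)
qed

section \<open>The Hermitian inner product and orthogonal projection\<close>

definition pweight :: "(nat \<Rightarrow>\<^sub>0 nat) \<Rightarrow> complex" where
  "pweight \<alpha> = (\<Prod>i=1..27. fact (Poly_Mapping.lookup \<alpha> i))"

lemma pinner_superset:
  assumes "finite S" "Poly_Mapping.keys Q \<subseteq> S"
  shows "pinner Q R = (\<Sum>\<alpha>\<in>S. pweight \<alpha> * Poly_Mapping.lookup Q \<alpha> * cnj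
      (Poly_Mapping.lookup R \<alpha>))"
proof -
  have "pinner Q R = (\<Sum>\<alpha>\<in>S \<union> Poly_Mapping.keys R. pweight \<alpha> *
      Poly_Mapping.lookup Q \<alpha> * cnj (Poly_Mapping.lookup R \<alpha>))"
    unfolding pinner_def pweight_def using assms
    by (intro sum.mono_neutral_left) (auto simp: in_keys_iff)
  also have "\<dots> = (\<Sum>\<alpha>\<in>S. pweight \<alpha> * Poly_Mapping.lookup Q \<alpha> * cnj
      (Poly_Mapping.lookup R \<alpha>))"
    using assms by (intro sum.mono_neutral_right) (auto simp: in_keys_iff)
  finally show ?thesis .
qed

lemma pinner_add_left: "pinner (P + Q) R = pinner P R + pinner Q R"
proof -
  let ?S = "Poly_Mapping.keys P \<union> Poly_Mapping.keys Q"
  have "Poly_Mapping.keys (P + Q) \<subseteq> ?S" by (rule keys_add)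
  then show ?thesis
    by (simp add: pinner_superset[of ?S] lookup_add algebra_simps sum.distrib)
qed

lemma pinner_scale_left: "pinner (cscale c Q) R = c * pinner Q R"
proof -
  have "Poly_Mapping.keys (cscale c Q) \<subseteq> Poly_Mapping.keys Q"
      by (auto simp: in_keys_iff lookup_cscale)
  then show ?thesis
    by (simp add: pinner_superset[of "Poly_Mapping.keys Q"] lookup_cscale sum_distrib_left algebra_simps)
qed

lemma pinner_commute: "pinner Q R = cnj (pinner R Q)"
  unfolding pinner_def by (simp add: Un_commute mult_ac)

lemma pinner_zero [simp]: "pinner 0 R = 0" "pinner R 0 = 0"
  by (auto simp: pinner_def)

lemma pinner_add_right: "pinner R (P + Q) = pinner R P + pinner R Q"
  and pinner_scale_right: "pinner R (cscale c Q) = cnj c * pinner R Q"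
  by (subst (1 2 3) pinner_commute, simp add: pinner_add_left)
    (subst (1 2) pinner_commute, simp add: pinner_scale_left)

text \<open>The weights are products of factorials, so \<open>pinner Q Q\<close> is a combination of
  squared moduli with positive real coefficients.\<close>

lemma pinner_eq_0: assumes "pinner Q Q = 0" shows "Q = 0"
proof -
  define w :: "(nat \<Rightarrow>\<^sub>0 nat) \<Rightarrow> real"
      where "w \<alpha> = (\<Prod>i=1..27. fact (Poly_Mapping.lookup \<alpha> i))" for \<alpha>
  have w: "w \<alpha> > 0" for \<alpha> unfolding w_def by (intro prod_pos) simp
  have "pinner Q Q = complex_of_real (\<Sum>\<alpha>\<in>Poly_Mapping.keys Q. w \<alpha> * (cmod
      (Poly_Mapping.lookup Q \<alpha>))\<^sup>2)"
    unfolding pinner_def w_def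
    by (simp add: mult.assoc flip: complex_norm_square of_real_power)
  then have "(\<Sum>\<alpha>\<in>Poly_Mapping.keys Q. w \<alpha> * (cmod
      (Poly_Mapping.lookup Q \<alpha>))\<^sup>2) = 0"
    using assms by (metis of_real_eq_0_iff)
  then have "\<forall>\<alpha>\<in>Poly_Mapping.keys Q. w \<alpha> * (cmod
      (Poly_Mapping.lookup Q \<alpha>))\<^sup>2 = 0"
    using w by (subst (asm) sum_nonneg_eq_0_iff) (auto simp: less_imp_le)
  then have "\<forall>\<alpha>\<in>Poly_Mapping.keys Q. Poly_Mapping.lookup Q \<alpha> = 0"
    using w by (auto simp: less_le)
  then have "Poly_Mapping.keys Q = {}" unfolding in_keys_iff by (auto simp del: keys_eq_empty)
  then show ?thesis by simp
qed

text \<open>Gram-Schmidt, one spanning vector at a time: \<open>b\<close> is first replaced by its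
  component \<open>b1\<close> orthogonal to the old span.\<close>

lemma orthogonal_projection:
  assumes "finite B"
  shows "\<exists>h q. Q = h + q \<and> q \<in> cpoly_span B \<and>
      (\<forall>R\<in>cpoly_span B. pinner h R = 0)"
  using assms
proof (induction B arbitrary: Q)
  case empty
  then show ?case by (auto intro!: exI[of _ Q])
next
  case (insert b B)
  obtain b1 b2 where b: "b = b1 + b2" "b2 \<in> cpoly_span B" "\<forall>R\<in>cpoly_span B. pinner b1 R = 0"
    using insert.IH by blast
  obtain h q where hq: "Q = h + q" "q \<in> cpoly_span B" "\<forall>R\<in>cpoly_span B. pinner h R = 0"
    using insert.IH by blast
  have mono: "cpoly_span B \<subseteq> cpoly_span (insert b B)" by (rule cpoly.span_mono) auto
  \<comment> \<open>The Fourier coefficient of \<open>h\<close> along \<open>b1\<close>. If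
    \<open>b1 = 0\<close>, division by zero gives \<open>c = 0\<close>, which is still the right
    choice.\<close>
  define c where "c = pinner h b1 / pinner b1 b1"
  define h' where "h' = h + cscale (- c) b1"
  have "b - b2 \<in> cpoly_span (insert b B)"
    by (rule cpoly.span_diff[OF cpoly.span_base[OF insertI1] subsetD[OF mono b(2)]])
  then have "b1 \<in> cpoly_span (insert b B)" using b(1) by simp
  then have q: "q + cscale c b1 \<in> cpoly_span (insert b B)"
    using hq mono by (auto intro!: cpoly.span_add cpoly.span_scale)
  have h1: "pinner h' b1 = 0"
    using pinner_eq_0[of b1] unfolding h'_def pinner_add_left pinner_scale_left c_def
    by (cases "b1 = 0") auto
  have h2: "pinner h' R = 0" if "R \<in> cpoly_span B" for R
    using that b hq unfolding h'_def pinner_add_left pinner_scale_left by simp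
  have "pinner h' R = 0" if R: "R \<in> cpoly_span (insert b B)" for R
  proof -
    obtain k where k: "R - cscale k b \<in> cpoly_span B" using R unfolding cpoly.span_insert by blast
    have "R = cscale k b1 + (cscale k b2 + (R - cscale k b))"
      by (simp add: b cpoly.scale_right_distrib)
    moreover have "cscale k b2 + (R - cscale k b) \<in> cpoly_span B"
      using k b by (intro cpoly.span_add cpoly.span_scale)
    ultimately show ?thesis
      by (metis h1 h2 add.right_neutral mult_zero_right pinner_add_right pinner_scale_right)
  qed
  moreover have "cscale (- c) b1 + cscale c b1 = 0" by (simp flip: cpoly.scale_left_distrib)
  then have "Q = h' + (q + cscale c b1)"
    by (simp add: h'_def hq algebra_simps)
  ultimately show ?case using q by blast
qed

definition inv_ideal :: "nat \<Rightarrow> cpoly set" where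
  "inv_ideal k = cpoly_span (\<Union>i\<in>{..<k}. span_products (harmonic i) (invpoly (k - i)))"

lemma harmonic_eq: "harmonic k = {Q \<in> hompoly k. \<forall>R\<in>inv_ideal k. pinner Q R = 0}"
  by (subst harmonic.simps) (auto simp: inv_ideal_def)

lemma harmonic_subset: "harmonic k \<subseteq> hompoly k"
  by (auto simp: harmonic_eq)

lemma subspace_harmonic: "cpoly.subspace (harmonic k)"
  using subspace_hompoly[of k] unfolding harmonic_eq cpoly.subspace_def
  by (auto simp: pinner_add_left pinner_scale_left)

lemma inv_ideal_subset: "inv_ideal k \<subseteq> hompoly k"
  unfolding inv_ideal_def
proof (intro cpoly.span_minimal subspace_hompoly UN_least)
  fix i assume i: "i \<in> {..<k}"
  have "{p * q | p q. p \<in> harmonic i \<and> q \<in> invpoly (k - i)} \<subseteq> hompoly (i + (k - i))"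
    using harmonic_subset by (auto simp: invpoly_def intro!: hompoly_mult)
  then show "span_products (harmonic i) (invpoly (k - i)) \<subseteq> hompoly k"
    unfolding span_products_def using i by (intro cpoly.span_minimal subspace_hompoly) auto
qed

text \<open>\<open>inv_ideal k\<close> lies in a finite-dimensional space, so it has a finite basis
  and \<open>orthogonal_projection\<close> applies; the remainder is harmonic by definition.\<close>

lemma hompoly_decomposition:
  "hompoly k = {h + q | h q. h \<in> harmonic k \<and> q \<in> inv_ideal k}"
proof
  have sub: "cpoly.subspace (inv_ideal k)" unfolding inv_ideal_def by (rule cpoly.subspace_span)
  show "hompoly k \<subseteq> {h + q | h q. h \<in> harmonic k \<and> q \<in> inv_ideal k}"
  proof
    fix Q assume Q: "Q \<in> hompoly k"
    obtain B where B: "B \<subseteq> inv_ideal k" "cpoly.independent B" "inv_ideal k \<subseteq> cpoly_span B"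
      using cpoly.maximal_independent_subset by blast
    have "finite B"
      using cpoly.independent_span_bound[OF finite_imageI[OF finite_hom_exps[of k]] B(2)]
        B(1) inv_ideal_subset hompoly_span by (metis (no_types, lifting) order_trans)
    then obtain h q where hq: "Q = h + q" "q \<in> cpoly_span B" "\<forall>R\<in>cpoly_span B. pinner h R = 0"
      using orthogonal_projection by blast
    have q: "q \<in> inv_ideal k" using cpoly.span_minimal[OF B(1) sub] hq by blast
    then have "Q - q \<in> hompoly k" using Q inv_ideal_subset
        by (intro cpoly.subspace_diff[OF subspace_hompoly]) auto
    then have "h \<in> harmonic k" using hq B by (auto simp: harmonic_eq)
    then show "Q \<in> {h + q | h q. h \<in> harmonic k \<and> q \<in> inv_ideal k}" using hq q by blast
  qed
  show "{h + q | h q. h \<in> harmonic k \<and> q \<in> inv_ideal k} \<subseteq> hompoly k"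
    using harmonic_subset inv_ideal_subset by (auto intro!: cpoly.subspace_add[OF subspace_hompoly])
qed

text \<open>Sums of different lengths are padded to a common length with the zero function.\<close>

lemma sum_spaces_add:
  assumes V: "\<And>k. (\<lambda>X\<in>P2O. 0) \<in> V k" "\<And>k f g. f \<in> V k \<Longrightarrow>
      g \<in> V k \<Longrightarrow> (\<lambda>X\<in>P2O. f X + g X) \<in> V k"
    and "F \<in> sum_spaces V" "G \<in> sum_spaces V"
  shows "(\<lambda>X\<in>P2O. F X + G X) \<in> sum_spaces V"
proof -
  have ext: "\<exists>f'. (\<forall>k. f' k \<in> V k) \<and>
      F = (\<lambda>X\<in>P2O. \<Sum>k<m. f' k X)"
      if F: "F = (\<lambda>X\<in>P2O. \<Sum>k<n. f k X)" "\<forall>k<n. f k \<in> V k" "n \<le> m"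
      for F f n m
  proof (intro exI conjI allI)
    let ?f = "\<lambda>k. if k < n then f k else (\<lambda>X\<in>P2O. 0)"
    show "?f k \<in> V k" for k using F V(1) by auto
    have "(\<Sum>k<m. ?f k X) = (\<Sum>k<n. f k X)" if "X \<in> P2O" for X
      using F(3) that by (intro sum.mono_neutral_cong_right) auto
    then show "F = (\<lambda>X\<in>P2O. \<Sum>k<m. ?f k X)" unfolding F by (auto simp: restrict_def)
  qed
  obtain n f where f: "F = (\<lambda>X\<in>P2O. \<Sum>k<n. f k X)" "\<forall>k<n. f k \<in> V k"
    using assms(3) unfolding sum_spaces_def by blast
  obtain n' g where g: "G = (\<lambda>X\<in>P2O. \<Sum>k<n'. g k X)" "\<forall>k<n'. g k \<in> V k"
    using assms(4) unfolding sum_spaces_def by blast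
  obtain f' where f': "\<forall>k. f' k \<in> V k" "F = (\<lambda>X\<in>P2O. \<Sum>k<max n n'. f' k X)"
    using ext[OF f max.cobounded1] by blast
  obtain g' where g': "\<forall>k. g' k \<in> V k" "G = (\<lambda>X\<in>P2O. \<Sum>k<max n n'. g' k X)"
    using ext[OF g max.cobounded2] by blast
  have "(\<lambda>X\<in>P2O. F X + G X) =
      (\<lambda>X\<in>P2O. \<Sum>k<max n n'. (\<lambda>X\<in>P2O. f' k X + g' k X) X)"
    using f' g' by (auto simp: sum.distrib restrict_def)
  then show ?thesis unfolding sum_spaces_def using f' g' V(2)
    by (auto intro!: exI[of _ "max n n'"] exI[of _ "\<lambda>k. \<lambda>X\<in>P2O. f' k X + g' k X"])
qed

section \<open>Restriction of polynomials to the projective plane\<close>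

lemma restr_add: "restr (P + Q) = (\<lambda>X\<in>P2O. restr P X + restr Q X)"
  and restr_cscale: "restr (cscale c Q) = (\<lambda>X\<in>P2O. c * restr Q X)"
  and restr_zero: "restr 0 = (\<lambda>X\<in>P2O. 0)"
  by (auto simp: restr_def restrict_def peval_add peval_cscale)

lemma subspace_allpoly: "cpoly.subspace allpoly"
  unfolding allpoly_def by (rule cpoly.subspace_span)

lemma hompoly_allpoly: "hompoly k \<subseteq> allpoly"
  unfolding allpoly_def by (auto intro: cpoly.span_base)

text \<open>On \<open>P2O\<close> an invariant factor is a constant, so a product of
  \<open>p\<close> in \<open>harmonic i\<close> with an invariant restricts to a multiple of
  \<open>restr p\<close>. The ideal part of every degree thus falls into the sum at once, without
  recursion on the degree.\<close>

lemma restr_allpoly_eq: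
  assumes const: "\<And>k Q. Q \<in> invpoly k \<Longrightarrow> peval Q constant_on P2O"
  shows "restr ` allpoly = sum_spaces (\<lambda>k. restr ` harmonic k)"
proof
  let ?V = "\<lambda>k. restr ` harmonic k"
  note sub = subspace_harmonic
  have V0: "(\<lambda>X\<in>P2O. 0) \<in> ?V k" for k
    using cpoly.subspace_0[OF sub[of k]] by (force simp: restr_zero[symmetric])
  have Vadd: "(\<lambda>X\<in>P2O. f X + g X) \<in> ?V k" if "f \<in> ?V k" "g \<in> ?V k" for k f g
    using that cpoly.subspace_add[OF sub[of k]] by (auto simp: restr_add[symmetric])
  note add = sum_spaces_add[of ?V, OF V0 Vadd]
  have single: "restr Q \<in> sum_spaces ?V" if Q: "Q \<in> harmonic k" for Q k
  proof -
    let ?f = "\<lambda>i. if i = k then restr Q else (\<lambda>X\<in>P2O. 0)"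
    have "restr Q = (\<lambda>X\<in>P2O. \<Sum>i<Suc k. ?f i X)"
      by (auto simp: restr_def restrict_def)
    moreover have "\<forall>i<Suc k. ?f i \<in> ?V i" using Q V0 by auto
    ultimately show ?thesis unfolding sum_spaces_def
      by (intro CollectI exI[of _ "Suc k"] exI[of _ ?f] conjI)
  qed
  \<comment> \<open>The preimage of the sum under \<open>restr\<close> is a subspace of polynomials,
    so spans can be treated by \<open>span_minimal\<close>.\<close>
  let ?S = "{Q. restr Q \<in> sum_spaces ?V}"
  have S: "cpoly.subspace ?S"
  proof (rule cpoly.subspaceI)
    show "0 \<in> ?S" using single[OF cpoly.subspace_0[OF sub[of 0]]] by simp
    show "P + Q \<in> ?S" if "P \<in> ?S" "Q \<in> ?S" for P Q
      unfolding restr_add mem_Collect_eq by (rule add) (use that in simp_all)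
    show "cscale c Q \<in> ?S" if Q: "Q \<in> ?S" for c Q
    proof -
      obtain n f where f: "restr Q = (\<lambda>X\<in>P2O. \<Sum>k<n. f k X)" "\<forall>k<n. f k \<in> ?V k"
        using Q unfolding sum_spaces_def mem_Collect_eq by blast
      have "(\<lambda>X\<in>P2O. c * f k X) \<in> ?V k" if "k < n" for k
      proof -
        obtain h where "h \<in> harmonic k" "f k = restr h" using f(2) \<open>k < n\<close> by blast
        then show ?thesis using cpoly.subspace_scale[OF sub[of k]] by (metis image_eqI restr_cscale)
      qed
      moreover have "restr (cscale c Q) = (\<lambda>X\<in>P2O. \<Sum>k<n. (\<lambda>X\<in>P2O. c * f k X) X)"
        unfolding restr_cscale f by (auto simp: sum_distrib_left restrict_def)
      ultimately show ?thesis
        unfolding sum_spaces_def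
        by (intro CollectI exI[of _ n] exI[of _ "\<lambda>k. \<lambda>X\<in>P2O. c * f k X"] conjI) auto
    qed
  qed
  have prod: "p * q \<in> ?S" if p: "p \<in> harmonic i" and q: "q \<in> invpoly j" for p q i j
  proof -
    obtain c where "\<forall>X\<in>P2O. peval q X = c" using const[OF q] unfolding constant_on_def by blast
    then have "restr (p * q) = restr (cscale c p)"
      by (auto simp: restr_def restrict_def peval_mult peval_cscale)
    then show ?thesis using single[OF cpoly.subspace_scale[OF sub p]] by simp
  qed
  have "inv_ideal k \<subseteq> ?S" for k
    unfolding inv_ideal_def span_products_def
    by (intro cpoly.span_minimal[OF _ S] UN_least) (use prod in auto)
  moreover have "harmonic k \<subseteq> ?S" for k using single by auto
  ultimately have "hompoly k \<subseteq> ?S" for k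
    unfolding hompoly_decomposition using cpoly.subspace_add[OF S] by blast
  then have "allpoly \<subseteq> ?S" unfolding allpoly_def by (intro cpoly.span_minimal[OF _ S]) auto
  then show "restr ` allpoly \<subseteq> sum_spaces ?V" by auto
  show "sum_spaces ?V \<subseteq> restr ` allpoly"
  proof
    fix F assume "F \<in> sum_spaces ?V"
    then obtain n f where f: "F = (\<lambda>X\<in>P2O. \<Sum>k<n. f k X)" "\<forall>k<n. f k \<in> ?V k"
      unfolding sum_spaces_def by blast
    then obtain h where h: "\<And>k. k < n \<Longrightarrow> h k \<in> harmonic k \<and> f k = restr (h k)"
      unfolding image_iff by metis
    have "F = restr (\<Sum>k<n. h k)"
      unfolding f using h by (auto simp: restr_def restrict_def peval_sum intro!: sum.cong)
    moreover have "(\<Sum>k<n. h k) \<in> allpoly"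
      using h harmonic_subset hompoly_allpoly by (intro cpoly.subspace_sum[OF subspace_allpoly]) blast
    ultimately show "F \<in> restr ` allpoly" by blast
  qed
qed

section \<open>Finite differentiability\<close>

text \<open>Truncated powers have only finitely many derivatives, so smoothness is graded. The
  recursion removes the derivative taken first, the last entry of the list in
  \<open>iter_deriv\<close>; hence the reverse induction in \<open>Ck_iter_deriv\<close>.\<close>

primrec Ck :: "nat \<Rightarrow> 'a set \<Rightarrow> ('a::real_normed_vector \<Rightarrow>
    'b::real_normed_vector) \<Rightarrow> bool" where
  "Ck 0 U f = continuous_on U f"
| "Ck (Suc k) U f \<longleftrightarrow> (\<forall>x\<in>U. f differentiable (at x)) \<and>
     (\<forall>v. Ck k U (\<lambda>x. frechet_derivative f (at x) v))"

lemma has_derivative_cong_open: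
  assumes "open U" "x \<in> U" "\<And>y. y \<in> U \<Longrightarrow> f y = g y"
  shows "(f has_derivative D) (at x) \<longleftrightarrow> (g has_derivative D) (at x)"
  using assms by (metis has_derivative_transform_within_open)

lemma frechet_derivative_cong_open:
  assumes "open U" "x \<in> U" "\<And>y. y \<in> U \<Longrightarrow> f y = g y"
  shows "frechet_derivative f (at x) = frechet_derivative g (at x)"
  unfolding frechet_derivative_def using has_derivative_cong_open[OF assms] by simp

lemma Ck_cong:
  assumes "open U" "\<And>x. x \<in> U \<Longrightarrow> f x = g x"
  shows "Ck k U f \<longleftrightarrow> Ck k U g"
  using assms(2)
proof (induction k arbitrary: f g)
  case 0
  then show ?case by (simp cong: continuous_on_cong)
next
  case (Suc k)
  have d: "frechet_derivative f (at x) = frechet_derivative g (at x)" if "x \<in> U" for x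
    using frechet_derivative_cong_open assms(1) that Suc.prems by blast
  have "f differentiable (at x) \<longleftrightarrow> g differentiable (at x)" if "x \<in> U" for x
    unfolding differentiable_def using has_derivative_cong_open[OF assms(1) that] Suc.prems by blast
  then show ?case
    using Suc.IH[of "\<lambda>x. frechet_derivative f (at x) v" "\<lambda>x. frechet_derivative g
        (at x) v" for v] d
    by simp
qed

lemma iter_deriv_cong:
  assumes "open U" "\<And>x. x \<in> U \<Longrightarrow> f x = g x" "x \<in> U"
  shows "iter_deriv vs f x = iter_deriv vs g x"
  using assms(3)
proof (induction vs arbitrary: x)
  case (Cons v vs)
  have "frechet_derivative (iter_deriv vs f) (at x) = frechet_derivative (iter_deriv vs g) (at x)"
    using frechet_derivative_cong_open[OF assms(1) Cons.prems] Cons.IH by blast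
  then show ?case by simp
qed (use assms in auto)

lemma Ck_SucI:
  assumes "open U" "\<And>x. x \<in> U \<Longrightarrow>
      (f has_derivative f' x) (at x)" "\<And>v. Ck k U (\<lambda>x. f' x v)"
  shows "Ck (Suc k) U f"
proof -
  have "frechet_derivative f (at x) = f' x" if "x \<in> U" for x
    using assms(2)[OF that] frechet_derivative_at by metis
  then have "Ck k U (\<lambda>x. frechet_derivative f (at x) v)" for v
    using Ck_cong[OF assms(1), of "\<lambda>x. frechet_derivative f
        (at x) v" "\<lambda>x. f' x v"] assms(3) by simp
  then show ?thesis using assms(2) by (auto simp: differentiable_def)
qed

lemma Ck_has_derivative:
  assumes "Ck (Suc k) U f" "x \<in> U"
  shows "(f has_derivative frechet_derivative f (at x)) (at x)"
  using assms by (simp flip: frechet_derivative_works)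

lemma Ck_frechet_derivative: "Ck (Suc k) U f \<Longrightarrow>
    Ck k U (\<lambda>x. frechet_derivative f (at x) v)"
  by simp

lemma Ck_Suc_imp: "Ck (Suc k) U f \<Longrightarrow> Ck k U f"
proof (induction k arbitrary: f)
  case 0
  then show ?case
    by (auto intro!: continuous_at_imp_continuous_on differentiable_imp_continuous_within)
next
  case (Suc k)
  then show ?case by (metis Ck.simps(2))
qed

lemma Ck_le: "Ck k U f \<Longrightarrow> j \<le> k \<Longrightarrow> Ck j U f"
  by (induction k arbitrary: j) (auto simp: le_Suc_eq simp del: Ck.simps intro: Ck_Suc_imp)

lemma Ck_continuous_on: "Ck k U f \<Longrightarrow> continuous_on U f"
  using Ck_le[of k U f 0] by simp

lemma Ck_const: "open U \<Longrightarrow> Ck k U (\<lambda>x. c)"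
proof (induction k arbitrary: c)
  case (Suc k)
  show ?case by (rule Ck_SucI[where f' = "\<lambda>_ _. 0"]) (use Suc in auto)
qed auto

lemma Ck_add:
  assumes "open U" "Ck k U f" "Ck k U g" shows "Ck k U (\<lambda>x. f x + g x)"
  using assms(2,3)
proof (induction k arbitrary: f g)
  case (Suc k)
  show ?case
    by (rule Ck_SucI[OF assms(1) has_derivative_add[OF Ck_has_derivative Ck_has_derivative]])
      (use Suc Ck_frechet_derivative in blast)+
qed (auto intro: continuous_intros)

lemma Ck_bounded_linear:
  assumes "bounded_linear L" "open U" "Ck k U f" shows "Ck k U (\<lambda>x. L (f x))"
  using assms(3)
proof (induction k arbitrary: f)
  case 0
  then show ?case by (auto intro: bounded_linear.continuous_on[OF assms(1)])
next
  case (Suc k)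
  show ?case
    by (rule Ck_SucI[OF assms(2) bounded_linear.has_derivative[OF assms(1) Ck_has_derivative]])
      (use Suc Ck_frechet_derivative in blast)+
qed

lemma Ck_diff:
  assumes "open U" "Ck k U f" "Ck k U g" shows "Ck k U (\<lambda>x. f x - g x)"
  using Ck_add[OF assms(1,2) Ck_bounded_linear[OF bounded_linear_minus[OF bounded_linear_ident]
      assms(1,3)]] by simp

lemma Ck_id: "open U \<Longrightarrow> Ck k U (\<lambda>x. x)"
proof (cases k)
  case (Suc j)
  assume "open U"
  then show ?thesis unfolding Suc
    by (intro Ck_SucI[where f' = "\<lambda>_ v. v"]) (auto intro: Ck_const)
qed auto

text \<open>One Leibniz argument for multiplication, scaling and inner products.\<close>

lemma (in bounded_bilinear) Ck_bilinear:
  assumes "open U" "Ck k U f" "Ck k U g" shows "Ck k U (\<lambda>x. prod (f x) (g x))"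
  using assms(2,3)
proof (induction k arbitrary: f g)
  case 0
  then show ?case by (auto intro: continuous_on)
next
  case (Suc k)
  show ?case
  proof (rule Ck_SucI[OF assms(1) FDERIV[OF Ck_has_derivative Ck_has_derivative]])
    show "Ck k U (\<lambda>x. prod (f x) (frechet_derivative g (at x) v) + prod (frechet_derivative f
        (at x) v) (g x))" for v
      by (intro Ck_add assms(1) Suc.IH Suc.prems[THEN Ck_frechet_derivative] Suc.prems[THEN Ck_Suc_imp])
  qed (use Suc.prems in blast)+
qed

lemmas Ck_mult = bounded_bilinear.Ck_bilinear[OF bounded_bilinear_mult]
lemmas Ck_scaleR = bounded_bilinear.Ck_bilinear[OF bounded_bilinear_scaleR]
lemmas Ck_inner = bounded_bilinear.Ck_bilinear[OF bounded_bilinear_inner]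

lemma Ck_sum:
  assumes "open U" "\<And>i. i \<in> I \<Longrightarrow>
      Ck k U (f i)" shows "Ck k U (\<lambda>x. \<Sum>i\<in>I. f i x)"
  using assms(2) by (induction I rule: infinite_finite_induct) (auto intro: Ck_const Ck_add assms(1))

lemma Ck_power:
  fixes f :: "'a::real_normed_vector \<Rightarrow> 'b::{real_normed_algebra_1}"
  assumes "open U" "Ck k U f" shows "Ck k U (\<lambda>x. f x ^ n)"
  by (induction n) (auto intro: Ck_const Ck_mult assms)

lemma Ck_prod:
  fixes f :: "'i \<Rightarrow> 'a::real_normed_vector \<Rightarrow> 'b::{real_normed_algebra_1, comm_ring_1}"
  assumes "open U" "\<And>i. i \<in> I \<Longrightarrow>
      Ck k U (f i)" shows "Ck k U (\<lambda>x. \<Prod>i\<in>I. f i x)"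
  using assms(2) by (induction I rule: infinite_finite_induct) (auto intro: Ck_const Ck_mult assms(1))

text \<open>The derivative is a product of \<open>inverse (f x)\<close> and a derivative of
  \<open>f\<close>, so the induction on \<open>k\<close> closes.\<close>

lemma Ck_inverse:
  fixes f :: "'a::real_normed_vector \<Rightarrow> real"
  assumes "open U" "Ck k U f" "\<And>x. x \<in> U \<Longrightarrow>
      f x \<noteq> 0" shows "Ck k U (\<lambda>x. inverse (f x))"
  using assms(2,3)
proof (induction k arbitrary: f)
  case 0
  then show ?case by (auto intro: continuous_on_inverse)
next
  case (Suc k)
  have "((\<lambda>x. inverse (f x)) has_derivative
      (\<lambda>h. - (inverse (f x) * frechet_derivative f (at x) h * inverse (f x)))) (at x)"
          if "x \<in> U" for x
    using Ck_has_derivative[OF Suc.prems(1) that] Suc.prems(2)[OF that]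
    by (simp add: has_derivative_inverse)
  moreover have "Ck k U (\<lambda>x. - (inverse (f x) * frechet_derivative f (at x) v * inverse (f x)))" for v
    by (intro Ck_bounded_linear[OF bounded_linear_minus[OF bounded_linear_ident]] Ck_mult assms(1) Suc.IH
        Suc.prems(1)[THEN Ck_frechet_derivative] Suc.prems(1)[THEN Ck_Suc_imp] Suc.prems(2))
  ultimately show ?case by (rule Ck_SucI[OF assms(1)])
qed

text \<open>The exponent is at least 2, so at \<open>t = 0\<close> the difference quotient
  \<open>max 0 h ^ Suc m\<close> still tends to 0.\<close>

lemma has_real_derivative_max_power:
  "((\<lambda>t::real. max 0 t ^ (Suc (Suc m))) has_real_derivative real (Suc
      (Suc m)) * max 0 t ^ Suc m) (at t)"
proof (cases "t = 0")
  case False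
  then consider "t > 0" | "t < 0" by linarith
  then show ?thesis
  proof cases
    case 1
    have "((\<lambda>t::real. t ^ (Suc (Suc m))) has_real_derivative real (Suc
        (Suc m)) * max 0 t ^ Suc m) (at t)"
      using 1 DERIV_pow[of "Suc (Suc m)" t] by simp
    then show ?thesis
      by (rule has_field_derivative_transform_within_open[of _ _ _ "{0<..}"]) (use 1 in auto)
  next
    case 2
    have "((\<lambda>t::real. 0) has_real_derivative real (Suc (Suc m)) * max 0 t ^ Suc m) (at t)"
      using 2 by (auto intro!: derivative_eq_intros)
    then show ?thesis
      by (rule has_field_derivative_transform_within_open[of _ _ _ "{..<0}"]) (use 2 in auto)
  qed
next
  case True
  have "((\<lambda>h::real. max 0 h ^ Suc m) \<longlongrightarrow> max 0 0 ^ Suc m) (at 0)"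
    by (intro tendsto_intros)
  then have "((\<lambda>h::real. max 0 h ^ Suc m) \<longlongrightarrow> 0) (at 0)" by simp
  then have "((\<lambda>h::real. max 0 h ^ Suc (Suc m) / h) \<longlongrightarrow> 0) (at 0)"
    by (rule Lim_transform_eventually) (auto simp: eventually_at_filter max_def)
  then show ?thesis using True by (simp add: DERIV_def)
qed

text \<open>Each differentiation lowers the exponent by one, which accounts for
  \<open>k < m\<close>.\<close>

lemma Ck_max_power:
  fixes q :: "'a::real_normed_vector \<Rightarrow> real"
  assumes "open U" "Ck k U q" "k < m" shows "Ck k U (\<lambda>x. max 0 (q x) ^ m)"
  using assms(2,3)
proof (induction k arbitrary: m)
  case 0
  then show ?case by (auto intro!: continuous_intros)
next
  case (Suc k)
  obtain n where m: "m = Suc (Suc n)" using Suc.prems(2) by (cases m; cases "m - 1") auto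
  have "((\<lambda>x. max 0 (q x) ^ m) has_derivative
      (\<lambda>h. real m * max 0 (q x) ^ Suc n * frechet_derivative q (at x) h)) (at x)" if "x \<in> U" for x
    using has_derivative_compose[OF Ck_has_derivative[OF Suc.prems(1) that]
        has_real_derivative_max_power[of n "q x", unfolded has_field_derivative_def]]
    by (simp add: m)
  moreover have "Ck k U (\<lambda>x. real m * max 0 (q x) ^ Suc n * frechet_derivative q (at x) v)" for v
    using Suc.prems(2) m
    by (intro Ck_mult Ck_const assms(1) Suc.IH Suc.prems(1)[THEN Ck_frechet_derivative]
        Suc.prems(1)[THEN Ck_Suc_imp]) simp
  ultimately show ?case by (rule Ck_SucI[OF assms(1)])
qed

lemma iter_deriv_append: "iter_deriv (vs @ ws) f = iter_deriv vs (iter_deriv ws f)"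
  by (induction vs) auto

lemma Ck_iter_deriv: "Ck (length vs + k) U f \<Longrightarrow> Ck k U (iter_deriv vs f)"
proof (induction vs arbitrary: f rule: rev_induct)
  case (snoc v vs)
  then show ?case by (simp add: iter_deriv_append)
qed simp

lemma iter_deriv_add:
  assumes U: "open U" and "Ck (length vs) U f" "Ck (length vs) U g" "x \<in> U"
  shows "iter_deriv vs (\<lambda>x. f x + g x) x = iter_deriv vs f x + iter_deriv vs g x"
  using assms(2-)
proof (induction vs arbitrary: x)
  case (Cons v vs)
  have f: "Ck (Suc 0) U (iter_deriv vs f)" and g: "Ck (Suc 0) U (iter_deriv vs g)"
    using Cons.prems by (auto intro!: Ck_iter_deriv simp del: Ck.simps)
  have eq: "iter_deriv vs (\<lambda>x. f x + g x) y = iter_deriv vs f y + iter_deriv vs g y"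
      if "y \<in> U" for y
    using Cons.IH[OF _ _ that] Cons.prems by (simp add: Ck_Suc_imp del: Ck.simps)
  have "frechet_derivative (iter_deriv vs (\<lambda>x. f x + g x)) (at x) =
        frechet_derivative (\<lambda>x. iter_deriv vs f x + iter_deriv vs g x) (at x)"
    by (rule frechet_derivative_cong_open[OF U Cons.prems(3) eq])
  also have "\<dots> = (\<lambda>h. frechet_derivative (iter_deriv vs f) (at x) h + frechet_derivative
      (iter_deriv vs g) (at x) h)"
    by (rule frechet_derivative_at[symmetric])
      (intro has_derivative_add Ck_has_derivative[OF f] Ck_has_derivative[OF g] Cons.prems)
  finally show ?case by simp
qed simp

lemma iter_deriv_uminus:
  assumes U: "open U" and "Ck (length vs) U f" "x \<in> U"
  shows "iter_deriv vs (\<lambda>x. - f x) x = - iter_deriv vs f x"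
  using assms(2-)
proof (induction vs arbitrary: x)
  case (Cons v vs)
  have f: "Ck (Suc 0) U (iter_deriv vs f)"
    using Cons.prems by (auto intro!: Ck_iter_deriv simp del: Ck.simps)
  have eq: "iter_deriv vs (\<lambda>x. - f x) y = - iter_deriv vs f y" if "y \<in> U" for y
    using Cons.IH[OF _ that] Cons.prems by (simp add: Ck_Suc_imp del: Ck.simps)
  have "frechet_derivative (iter_deriv vs (\<lambda>x. - f x)) (at x) =
        frechet_derivative (\<lambda>x. - iter_deriv vs f x) (at x)"
    by (rule frechet_derivative_cong_open[OF U Cons.prems(2) eq])
  also have "\<dots> = (\<lambda>h. - frechet_derivative (iter_deriv vs f) (at x) h)"
    by (rule frechet_derivative_at[symmetric])
      (intro has_derivative_minus Ck_has_derivative[OF f] Cons.prems)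
  finally show ?case by simp
qed simp

lemma iter_deriv_diff:
  assumes U: "open U" and "Ck (length vs) U f" "Ck (length vs) U g" "x \<in> U"
  shows "iter_deriv vs (\<lambda>x. f x - g x) x = iter_deriv vs f x - iter_deriv vs g x"
proof -
  have "Ck (length vs) U (\<lambda>x. - g x)"
    using Ck_bounded_linear[OF bounded_linear_minus[OF bounded_linear_ident] assms(1,3)] .
  from iter_deriv_add[OF assms(1,2) this assms(4)] show ?thesis
    by (simp add: iter_deriv_uminus[OF assms(1,3,4)])
qed

lemma iter_deriv_zero: "iter_deriv vs (\<lambda>x. 0) = (\<lambda>x. 0)"
  by (induction vs) (auto simp: frechet_derivative_const)

lemma iter_deriv_sum:
  assumes U: "open U" and "finite I" "\<And>i. i \<in> I \<Longrightarrow> Ck (length vs) U (f i)" "x \<in> U"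
  shows "iter_deriv vs (\<lambda>x. \<Sum>i\<in>I. f i x) x = (\<Sum>i\<in>I. iter_deriv vs (f i) x)"
  using assms(2,3)
proof (induction I rule: finite_induct)
  case (insert i I)
  then show ?case
    using iter_deriv_add[OF U _ Ck_sum[OF U] assms(4), of vs "f i" I f] by simp
qed (simp add: iter_deriv_zero)

lemma smooth_on_open_imp_Ck: "smooth_on_open U f \<Longrightarrow> Ck k U f"
proof (induction k arbitrary: f)
  case 0
  then have "iter_deriv [] f differentiable_on U" unfolding smooth_on_open_def by blast
  then show ?case by (simp add: differentiable_imp_continuous_on)
next
  case (Suc k)
  then have "iter_deriv [] f differentiable_on U" "open U" unfolding smooth_on_open_def by blast+
  then have "\<forall>x\<in>U. f differentiable (at x)"
    by (simp add: differentiable_on_eq_differentiable_at)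
  moreover have "smooth_on_open U (\<lambda>x. frechet_derivative f (at x) v)" for v
    unfolding smooth_on_open_def
  proof (intro conjI allI)
    fix vs
    have "iter_deriv (vs @ [v]) f differentiable_on U" using Suc.prems unfolding smooth_on_open_def by blast
    then show "iter_deriv vs (\<lambda>x. frechet_derivative f (at x) v) differentiable_on U"
      by (simp add: iter_deriv_append)
  qed fact
  ultimately show ?case using Suc.IH by simp
qed

lemma Ck_imp_smooth_on_open:
  assumes "open U" "\<And>k. Ck k U f" shows "smooth_on_open U f"
  unfolding smooth_on_open_def
proof (intro conjI allI assms(1))
  fix vs
  have "Ck (Suc 0) U (iter_deriv vs f)" using assms(2) by (rule Ck_iter_deriv)
  then show "iter_deriv vs f differentiable_on U"
    by (auto simp: differentiable_on_def differentiable_at_withinI)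
qed

section \<open>Polynomial approximation by convolution\<close>

text \<open>The variable \<open>x\<close> enters only through \<open>G\<close>, so derivatives fall
  on \<open>G\<close> and continuity of \<open>q\<close> is enough. The integral is confined to a
  box because a polynomial can imitate an approximate identity only on a compact set.\<close>

definition conv :: "'a::euclidean_space \<Rightarrow> ('a \<Rightarrow> real) \<Rightarrow>
    ('a \<Rightarrow> 'b::banach) \<Rightarrow> 'a \<Rightarrow> 'b" where
  "conv a q G x = integral (cbox (- a) a) (\<lambda>y. q y *\<^sub>R G (x - y))"

lemma conv_has_derivative:
  fixes G :: "'a::euclidean_space \<Rightarrow> 'b::banach"
  assumes q: "continuous_on UNIV q" and G: "Ck (Suc 0) UNIV G"
  shows "(conv a q G has_derivative (\<lambda>v. conv a q (\<lambda>z. frechet_derivative G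
      (at z) v) x)) (at x)"
proof -
  \<comment> \<open>\<open>leibniz_rule\<close> wants the derivative continuous as an
    operator-valued map; in finite dimension continuity in each direction gives this.\<close>
  define D where "D z = Blinfun (frechet_derivative G (at z))" for z
  note dG = Ck_has_derivative[OF G UNIV_I]
  have D: "blinfun_apply (D z) v = frechet_derivative G (at z) v" for z v
    unfolding D_def by (simp add: bounded_linear_Blinfun_apply has_derivative_bounded_linear[OF dG])
  have contD: "continuous_on UNIV D"
    using G by (intro continuous_on_blinfun_componentwise) (simp add: D)
  have contG: "continuous_on UNIV G" using Ck_continuous_on[OF G] .
  have cont2: "continuous_on S (\<lambda>p. D (f p))" if "continuous_on S f"
      for S and f :: "'c::topological_space \<Rightarrow> 'a"
    using continuous_on_compose2[OF contD that] by simp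
  have cont3: "continuous_on S (\<lambda>p. q (f p))" if "continuous_on S f"
      for S and f :: "'c::topological_space \<Rightarrow> 'a"
    using continuous_on_compose2[OF q that] by simp
  have cont4: "continuous_on S (\<lambda>p. G (f p))" if "continuous_on S f"
      for S and f :: "'c::topological_space \<Rightarrow> 'a"
    using continuous_on_compose2[OF contG that] by simp
  have "((\<lambda>x. integral (cbox (- a) a) (\<lambda>y. q y *\<^sub>R G (x - y))) has_derivative
      integral (cbox (- a) a) (\<lambda>y. q y *\<^sub>R D (x - y))) (at x within UNIV)"
  proof (rule leibniz_rule)
    fix z y :: 'a
    have "((\<lambda>x. x - y) has_derivative (\<lambda>v. v)) (at z)"
      by (auto intro!: derivative_eq_intros)
    from has_derivative_compose[OF this dG[of "z - y"]]
    have "((\<lambda>x. G (x - y)) has_derivative frechet_derivative G (at (z - y))) (at z)" .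
    then show "((\<lambda>x. q y *\<^sub>R G (x - y)) has_derivative blinfun_apply (q y *\<^sub>R D
        (z - y))) (at z within UNIV)"
      by (auto intro!: derivative_eq_intros simp: blinfun.scaleR_left D)
  next
    fix z
    show "(\<lambda>y. q y *\<^sub>R G (z - y)) integrable_on cbox (- a) a"
      by (intro integrable_continuous continuous_intros cont3 cont4)
  next
    show "continuous_on (UNIV \<times> cbox (- a) a) (\<lambda>(x, y). q y *\<^sub>R D (x - y))"
      unfolding split_beta by (intro continuous_intros cont2 cont3)
  qed auto
  moreover have "blinfun_apply (integral (cbox (- a) a) (\<lambda>y. q y *\<^sub>R D (x - y))) =
      (\<lambda>v. conv a q (\<lambda>z. frechet_derivative G (at z) v) x)"
    unfolding conv_def
    by (rule ext, subst blinfun_apply_integral)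
      (auto intro!: integrable_continuous continuous_intros cont2 cont3 simp: blinfun.scaleR_left D)
  moreover have "conv a q G = (\<lambda>x. integral (cbox (- a) a) (\<lambda>y. q y *\<^sub>R G (x - y)))"
    by (simp add: conv_def fun_eq_iff)
  ultimately show ?thesis by simp
qed

lemma iter_deriv_conv:
  fixes G :: "'a::euclidean_space \<Rightarrow> 'b::banach"
  assumes q: "continuous_on UNIV q" and G: "Ck (length vs) UNIV G"
  shows "iter_deriv vs (conv a q G) = conv a q (iter_deriv vs G)"
  using G
proof (induction vs)
  case (Cons v vs)
  have "Ck (Suc 0) UNIV (iter_deriv vs G)"
    using Cons.prems by (intro Ck_iter_deriv) (simp del: Ck.simps)
  from frechet_derivative_at[OF conv_has_derivative[OF q this]]
  have "frechet_derivative (conv a q (iter_deriv vs G)) (at x) v =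
      conv a q (\<lambda>z. frechet_derivative (iter_deriv vs G) (at z) v) x" for x
    by metis
  then show ?case using Cons by (auto simp: Ck_Suc_imp simp del: Ck.simps)
qed simp

lemma sum_list_mult_product:
  fixes f g :: "_ \<Rightarrow> real"
  shows "sum_list (map f xs) * sum_list (map g ys) =
      sum_list (map (\<lambda>(u, v). f u * g v) (List.product xs ys))"
  by (induction xs) (simp_all add: distrib_right sum_list_const_mult comp_def)

text \<open>A polynomial kernel has finite rank in \<open>(x, y)\<close>. Convolution with it is
  therefore a polynomial in \<open>x\<close> whatever the other function is: the factors in
  \<open>y\<close> integrate to constant vectors.\<close>

lemma real_polynomial_function_diff_separable:
  fixes q :: "'a::real_normed_vector \<Rightarrow> real"
  assumes "real_polynomial_function q"
  shows "\<exists>L. (\<forall>(p, r)\<in>set L. real_polynomial_function p \<and> continuous_on UNIV r) \<and>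
    (\<forall>x y. q (x - y) = (\<Sum>(p, r)\<leftarrow>L. p x * r y))"
  using assms
proof (induction q rule: real_polynomial_function.induct)
  case (linear f)
  then show ?case
    by (intro exI[of _ "[(f, \<lambda>_. 1), (\<lambda>_. 1, \<lambda>y. - f y)]"])
      (auto simp: linear_diff bounded_linear.linear intro: continuous_intros linear_continuous_on)
next
  case (const c)
  show ?case by (rule exI[of _ "[(\<lambda>_. c, \<lambda>_. 1)]"]) auto
next
  case (add f g)
  then obtain L L' where
    "\<forall>(p, r)\<in>set L. real_polynomial_function p \<and>
        continuous_on UNIV r" "\<forall>x y. f (x - y) = (\<Sum>(p, r)\<leftarrow>L. p x * r y)"
    "\<forall>(p, r)\<in>set L'. real_polynomial_function p \<and>
        continuous_on UNIV r" "\<forall>x y. g (x - y) = (\<Sum>(p, r)\<leftarrow>L'. p x * r y)"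
    by blast
  then show ?case by (intro exI[of _ "L @ L'"]) auto
next
  case (mult f g)
  then obtain L L' where L:
    "\<forall>(p, r)\<in>set L. real_polynomial_function p \<and>
        continuous_on UNIV r" "\<forall>x y. f (x - y) = (\<Sum>(p, r)\<leftarrow>L. p x * r y)"
    "\<forall>(p, r)\<in>set L'. real_polynomial_function p \<and>
        continuous_on UNIV r" "\<forall>x y. g (x - y) = (\<Sum>(p, r)\<leftarrow>L'. p x * r y)"
    by blast
  let ?h = "\<lambda>((p, r), (p', r')). (\<lambda>x. p x * p' x, \<lambda>y. r y * r' y)"
  have "(\<Sum>(p, r)\<leftarrow>L. p x * r y) * (\<Sum>(p, r)\<leftarrow>L'. p x * r y) =
      (\<Sum>(p, r)\<leftarrow>map ?h (List.product L L'). p x * r y)" for x y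
    unfolding sum_list_mult_product map_map comp_def by (intro arg_cong[of _ _ sum_list] map_cong) auto
  moreover have "\<forall>(p, r)\<in>set (map ?h (List.product L L')). real_polynomial_function p \<and>
      continuous_on UNIV r"
    using L(1,3) by (fastforce intro: continuous_on_mult)
  ultimately show ?case using L(2,4) by (intro exI[of _ "map ?h (List.product L L')"]) simp
qed

text \<open>If \<open>x\<close> and the support of \<open>G\<close> lie in the box of
  \<open>a\<close>, the differences \<open>x - z\<close> lie in the box of
  \<open>2 *\<^sub>R a\<close>; the doubled box thus sees the whole support.\<close>

lemma conv_eq_integral:
  fixes G :: "'a::euclidean_space \<Rightarrow> 'b::banach"
  assumes q: "continuous_on UNIV q" and G: "continuous_on UNIV G"
    and supp: "\<And>x. x \<notin> cbox (- a) a \<Longrightarrow> G x = 0" and x: "x \<in> cbox (- a) a"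
  shows "conv (2 *\<^sub>R a) q G x = integral (cbox (- a) a) (\<lambda>z. q (x - z) *\<^sub>R G z)"
proof -
  have "continuous_on (cbox (- a) a) (\<lambda>z. q (x - z) *\<^sub>R G z)"
    by (intro continuous_intros continuous_on_compose2[OF q] continuous_on_subset[OF G]) auto
  then have "((\<lambda>z. q (x - z) *\<^sub>R G z) has_integral integral (cbox (- a) a) (\<lambda>z. q
      (x - z) *\<^sub>R G z)) (cbox (- a) a)"
    using integrable_continuous integrable_integral by blast
  from has_integral_affinity[OF this, of "-1" x]
  have "((\<lambda>y. q y *\<^sub>R G (x - y)) has_integral integral (cbox (- a) a) (\<lambda>z. q
      (x - z) *\<^sub>R G z))
      ((\<lambda>z. x - z) ` cbox (- a) a)"
    by simp
  moreover have "q y *\<^sub>R G (x - y) = 0" if "y \<notin> (\<lambda>z. x - z) ` cbox (- a) a" for y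
    using that supp[of "x - y"] by force
  moreover have "(\<lambda>z. x - z) ` cbox (- a) a \<subseteq> cbox (- (2 *\<^sub>R a)) (2 *\<^sub>R a)"
    using x by (fastforce simp: mem_box inner_diff_left)
  ultimately have "((\<lambda>y. q y *\<^sub>R G (x - y)) has_integral integral (cbox (- a) a)
      (\<lambda>z. q (x - z) *\<^sub>R G z))
      (cbox (- (2 *\<^sub>R a)) (2 *\<^sub>R a))"
    by (rule has_integral_on_superset)
  then show ?thesis unfolding conv_def by (rule integral_unique)
qed

definition poly_comb :: "(('a \<Rightarrow> real) \<times> 'b::real_normed_vector) list \<Rightarrow>
    'a \<Rightarrow> 'b" where
  "poly_comb L x = (\<Sum>(p, c)\<leftarrow>L. p x *\<^sub>R c)"

lemma conv_polynomial:
  fixes G :: "'a::euclidean_space \<Rightarrow> 'b::banach"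
  assumes q: "real_polynomial_function q" and G: "continuous_on UNIV G"
    and supp: "\<And>x. x \<notin> cbox (- a) a \<Longrightarrow> G x = 0"
  shows "\<exists>L. (\<forall>(p, c)\<in>set L. real_polynomial_function p) \<and>
    (\<forall>x\<in>cbox (- a) a. conv (2 *\<^sub>R a) q G x = poly_comb L x)"
proof -
  obtain L where L: "\<forall>(p, r)\<in>set L. real_polynomial_function p \<and> continuous_on UNIV r"
      "\<And>x y. q (x - y) = (\<Sum>(p, r)\<leftarrow>L. p x * r y)"
    using real_polynomial_function_diff_separable[OF q] by blast
  let ?I = "\<lambda>r. integral (cbox (- a) a) (\<lambda>z. r z *\<^sub>R G z)"
  have qc: "continuous_on UNIV q"
    using q continuous_on_polymonial_function real_polynomial_function_eq by blast
  have "((\<lambda>z. (\<Sum>(p, r)\<leftarrow>L'. p x * r z) *\<^sub>R G z) has_integral (\<Sum>(p,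
      r)\<leftarrow>L'. p x *\<^sub>R ?I r)) (cbox (- a) a)"
    if "\<forall>(p, r)\<in>set L'. continuous_on UNIV r"
        for x and L' :: "(('a \<Rightarrow> real) \<times> ('a \<Rightarrow> real)) list"
    using that
  proof (induction L')
    case (Cons u L')
    obtain p r where u: "u = (p, r)" by fastforce
    have "continuous_on (cbox (- a) a) (\<lambda>z. r z *\<^sub>R G z)"
      using Cons.prems by (auto simp: u intro!: continuous_intros intro: continuous_on_subset[OF G]
          continuous_on_subset[of UNIV r])
    then have "((\<lambda>z. r z *\<^sub>R G z) has_integral ?I r) (cbox (- a) a)"
      using integrable_continuous integrable_integral by blast
    from has_integral_add[OF has_integral_cmul[OF this, of "p x"] Cons.IH] Cons.prems
    show ?case by (simp add: u scaleR_add_left)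
  qed simp
  from this[of L] L(1)
  have "integral (cbox (- a) a) (\<lambda>z. q (x - z) *\<^sub>R G z) =
      (\<Sum>(p, r)\<leftarrow>L. p x *\<^sub>R ?I r)" for x
    unfolding L(2) by (intro integral_unique) auto
  then have "conv (2 *\<^sub>R a) q G x = poly_comb (map (\<lambda>(p, r). (p, ?I r)) L) x"
      if "x \<in> cbox (- a) a" for x
    using conv_eq_integral[OF qc G supp that] by (simp add: poly_comb_def comp_def case_prod_unfold)
  then show ?thesis using L(1) by (intro exI[of _ "map (\<lambda>(p, r). (p, ?I r)) L"]) auto
qed

text \<open>A single kernel serves the whole family: it approximates a bump of mass 1, concentrated
  where every \<open>D\<close> varies by less than \<open>e / 3\<close>. Kernel error and variation
  of \<open>D\<close> contribute at most \<open>e / 3\<close> each.\<close>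

lemma conv_approx:
  fixes \<D> :: "('a::euclidean_space \<Rightarrow> 'b::banach) set"
  assumes fin: "finite \<D>" and cont: "\<And>D. D \<in> \<D> \<Longrightarrow> continuous_on UNIV D"
    and b: "\<And>i. i \<in> Basis \<Longrightarrow> b \<bullet> i > 0" and X: "bounded X" and e: "e > 0"
  shows "\<exists>q. real_polynomial_function q \<and>
      (\<forall>D\<in>\<D>. \<forall>x\<in>X. norm (conv b q D x - D x) < e)"
proof -
  define B where "B = cbox (- b) b"
  \<comment> \<open>Contains all arguments \<open>x - y\<close> and \<open>x\<close> that occur, so
    bounds and uniform continuity on this compact set suffice.\<close>
  define K where "K = (\<lambda>(x, y). x - y) ` (closure X \<times> insert 0 B)"
  have B: "compact B" "0 \<in> B" using b by (auto simp: B_def mem_box less_imp_le)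
  have K: "compact K"
    unfolding K_def split_beta using X B
    by (intro compact_continuous_image compact_Times continuous_intros) (auto simp: compact_closure)
  have inK: "x - y \<in> K" "x \<in> K" if "x \<in> X" "y \<in> B" for x y
  proof -
    have "x \<in> closure X" using that closure_subset by blast
    then show "x - y \<in> K" "x \<in> K"
      unfolding K_def using that by (auto intro: image_eqI[of _ _ "(x, y)"] image_eqI[of _ _ "(x, 0)"])
  qed
  have "\<exists>M>0. \<forall>D\<in>\<D>. \<forall>z\<in>K. norm (D z) \<le> M"
    using fin cont
  proof (induction \<D>)
    case (insert D \<D>)
    then obtain M where M: "M > 0" "\<forall>D\<in>\<D>. \<forall>z\<in>K. norm (D z) \<le> M" by auto
    have "bounded (D ` K)"
      using insert.prems K by (intro compact_imp_bounded compact_continuous_image)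
          (auto intro: continuous_on_subset)
    then obtain M' where "\<forall>z\<in>K. norm (D z) \<le> M'" unfolding bounded_iff by auto
    then show ?case using M by (intro exI[of _ "max M M'"]) (auto simp: le_max_iff_disj)
  qed (auto intro: zero_less_one)
  then obtain M where M: "M > 0" "\<And>D z. D \<in> \<D> \<Longrightarrow> z \<in> K \<Longrightarrow>
      norm (D z) \<le> M" by blast
  have "\<exists>\<delta>>0. \<forall>D\<in>\<D>. \<forall>z\<in>K. \<forall>w\<in>K. dist w z <
      \<delta> \<longrightarrow> dist (D w) (D z) < e / 3"
    using fin cont
  proof (induction \<D>)
    case (insert D \<D>)
    then obtain \<delta> where d: "\<delta> > 0" "\<forall>D\<in>\<D>. \<forall>z\<in>K.
        \<forall>w\<in>K. dist w z < \<delta> \<longrightarrow> dist (D w) (D z) < e / 3" by auto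
    have "uniformly_continuous_on K D"
      using insert.prems K by (intro compact_uniformly_continuous) (auto intro: continuous_on_subset)
    then obtain \<delta>' where d': "\<delta>' > 0" "\<forall>z\<in>K. \<forall>w\<in>K. dist w z <
        \<delta>' \<longrightarrow> dist (D w) (D z) < e / 3"
      unfolding uniformly_continuous_on_def using e by (metis divide_pos_pos zero_less_numeral)
    show ?case using d d' by (intro exI[of _ "min \<delta> \<delta>'"]) auto
  qed (auto intro: zero_less_one)
  then obtain \<delta> where \<delta>: "\<delta> > 0"
    "\<And>D z w. D \<in> \<D> \<Longrightarrow> z \<in> K \<Longrightarrow> w \<in> K \<Longrightarrow>
        dist w z < \<delta> \<Longrightarrow> dist (D w) (D z) < e / 3"
    by metis
  \<comment> \<open>A tent of radius \<open>\<delta>\<close>. It is normalised over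
    \<open>B\<close>, so its mass there is 1 even if it reaches beyond \<open>B\<close>.\<close>
  define \<phi>0 where "\<phi>0 y = max 0 (\<delta> - norm y)" for y :: 'a
  have c0: "continuous_on S \<phi>0" for S unfolding \<phi>0_def by (intro continuous_intros)
  \<comment> \<open>A nonnegative continuous function with integral 0 over a nondegenerate box
    vanishes on it, but the tent has value \<open>\<delta>\<close> at 0.\<close>
  have "integral B \<phi>0 \<noteq> 0"
  proof
    assume "integral B \<phi>0 = 0"
    moreover have "box (- b) b \<noteq> {}" using b by (auto simp: box_ne_empty intro: add_pos_pos)
    ultimately have "\<phi>0 0 = 0"
      using integral_cbox_eq_0_iff[of "- b" b \<phi>0] c0 B unfolding B_def by (auto simp: \<phi>0_def)
    then show False using \<delta> by (simp add: \<phi>0_def)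
  qed
  moreover have "integral B \<phi>0 \<ge> 0"
    unfolding B_def by (intro integral_nonneg integrable_continuous c0) (simp add: \<phi>0_def)
  ultimately have pos: "integral B \<phi>0 > 0" by simp
  define \<phi> where "\<phi> y = \<phi>0 y / integral B \<phi>0" for y
  have c: "continuous_on S \<phi>" for S unfolding \<phi>_def using c0 pos by (auto intro!: continuous_intros)
  have \<phi>: "\<phi> y \<ge> 0" "norm y \<ge> \<delta> \<Longrightarrow> \<phi> y = 0" for y
    using pos by (auto simp: \<phi>_def \<phi>0_def)
  have int\<phi>: "(\<phi> has_integral 1) B"
  proof -
    have "(\<phi>0 has_integral integral B \<phi>0) B"
      unfolding B_def by (intro integrable_integral integrable_continuous c0)
    from has_integral_divide[OF this, of "integral B \<phi>0"] show ?thesis using pos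
        by (simp add: \<phi>_def[abs_def])
  qed
  define V where "V = measure lborel B"
  have V: "V \<ge> 0" by (simp add: V_def)
  \<comment> \<open>Chosen so that the kernel error \<open>V * (\<eta> * M)\<close> is at most
    \<open>e / 3\<close>; \<open>V + 1\<close> keeps the denominator positive.\<close>
  define \<eta> where "\<eta> = e / (3 * (M * (V + 1)))"
  have \<eta>: "\<eta> > 0" using e M V by (simp add: \<eta>_def)
  obtain q where q: "real_polynomial_function q" "\<And>y. y \<in> B \<Longrightarrow>
      \<bar>\<phi> y - q y\<bar> < \<eta>"
    using Stone_Weierstrass_real_polynomial_function[OF B(1) c \<eta>] by blast
  have qc: "continuous_on S q" for S
    using q(1) continuous_on_polymonial_function real_polynomial_function_eq by blast
  have "norm (conv b q D x - D x) < e" if D: "D \<in> \<D>" and x: "x \<in> X" for D x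
  proof -
    have 1: "((\<lambda>y. q y *\<^sub>R D (x - y)) has_integral conv b q D x) B"
      unfolding conv_def B_def
      by (intro integrable_integral integrable_continuous continuous_intros qc continuous_on_compose2[OF
          cont[OF D]]) auto
    have 2: "((\<lambda>y. \<phi> y *\<^sub>R D x) has_integral D x) B"
      using has_integral_scaleR_left[OF int\<phi>, of "D x"] by simp
    have 3: "((\<lambda>y. \<eta> * M + \<phi> y * (e / 3)) has_integral V * (\<eta> * M) + 1 * (e / 3)) B"
      unfolding V_def B_def
      by (intro has_integral_add has_integral_mult_left int\<phi>[unfolded B_def])
        (use has_integral_const[of "\<eta> * M" "- b" b] in simp)
    have "norm (q y *\<^sub>R D (x - y) - \<phi> y *\<^sub>R D x) \<le> \<eta> * M + \<phi> y * (e / 3)"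
        if y: "y \<in> B" for y
    proof -
      \<comment> \<open>First \<open>q\<close> is replaced by \<open>\<phi>\<close>, then
        \<open>D (x - y)\<close> by \<open>D x\<close>.\<close>
      have "q y *\<^sub>R D (x - y) - \<phi> y *\<^sub>R D x =
          (q y - \<phi> y) *\<^sub>R D (x - y) + \<phi> y *\<^sub>R (D (x - y) - D x)"
        by (simp add: algebra_simps)
      also have "norm \<dots> \<le> \<bar>q y - \<phi> y\<bar> * norm (D (x - y)) + \<phi> y * norm (D
          (x - y) - D x)"
        using \<phi>(1)[of y] by (intro norm_triangle_le) simp
      also have "\<dots> \<le> \<eta> * M + \<phi> y * (e / 3)"
      proof (rule add_mono)
        show "\<bar>q y - \<phi> y\<bar> * norm (D (x - y)) \<le> \<eta> * M"
          using q(2)[OF y] M D inK[OF x y] \<eta> by (intro mult_mono) (auto simp: abs_minus_commute)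
        show "\<phi> y * norm (D (x - y) - D x) \<le> \<phi> y * (e / 3)"
        proof (cases "norm y < \<delta>")
          case True
          then have "dist (D (x - y)) (D x) < e / 3"
            using D inK[OF x y] by (intro \<delta>) (auto simp: dist_norm)
          then show ?thesis using \<phi>(1)[of y] by (intro mult_left_mono) (auto simp: dist_norm)
        qed (use \<phi>(2)[of y] in simp)
      qed
      finally show ?thesis .
    qed
    then have "norm (integral B (\<lambda>y. q y *\<^sub>R D
        (x - y) - \<phi> y *\<^sub>R D x)) \<le> integral B (\<lambda>y. \<eta> * M + \<phi> y * (e / 3))"
      using has_integral_diff[OF 1 2] 3
          by (intro integral_norm_bound_integral) (auto simp: has_integral_integrable)
    then have "norm (conv b q D x - D x) \<le> V * (\<eta> * M) + e / 3"
      using integral_unique[OF has_integral_diff[OF 1 2]] integral_unique[OF 3] by simp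
    also have "V * (\<eta> * M) = e / 3 * (V / (V + 1))"
    proof -
      have "\<eta> * M = e / (3 * (V + 1))" using M(1) by (simp add: \<eta>_def)
      then show ?thesis by simp
    qed
    also have "e / 3 * (V / (V + 1)) \<le> e / 3 * 1" using e V by (intro mult_left_mono) auto
    finally show ?thesis using e by simp
  qed
  then show ?thesis using q(1) by blast
qed

text \<open>The derivatives of \<open>F\<close> up to order \<open>k\<close> along basis vectors
  form one finite family, so one kernel fits them all; \<open>iter_deriv_conv\<close> identifies
  their convolutions with the derivatives of a single polynomial.\<close>

lemma Ck_polynomial_approx:
  fixes F :: "'a::euclidean_space \<Rightarrow> 'b::banach"
  assumes F: "Ck k UNIV F" and supp: "\<And>x. x \<notin> cbox (- a) a \<Longrightarrow> F x = 0"
    and a: "\<And>i. i \<in> Basis \<Longrightarrow> a \<bullet> i > 0" and e: "e > 0"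
  shows "\<exists>L. (\<forall>(p, c)\<in>set L. real_polynomial_function p) \<and>
    (\<forall>ws. length ws \<le> k \<longrightarrow> set ws \<subseteq> Basis \<longrightarrow>
      (\<forall>x\<in>box (- a) a. norm (iter_deriv ws (poly_comb L) x - iter_deriv ws F x) < e))"
proof -
  define W where "W = {ws. set ws \<subseteq> (Basis :: 'a set) \<and> length ws \<le> k}"
  have "finite W" unfolding W_def by (rule finite_lists_length_le) simp
  have Ck: "Ck (length ws) UNIV F" "continuous_on UNIV (iter_deriv ws F)" if "ws \<in> W" for ws
  proof -
    show *: "Ck (length ws) UNIV F" using that F Ck_le by (auto simp: W_def)
    then have "Ck 0 UNIV (iter_deriv ws F)" by (intro Ck_iter_deriv) simp
    then show "continuous_on UNIV (iter_deriv ws F)" by simp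
  qed
  obtain q where q: "real_polynomial_function q"
    "\<forall>D\<in>(\<lambda>ws. iter_deriv ws F) ` W. \<forall>x\<in>box (- a) a. norm (conv
        (2 *\<^sub>R a) q D x - D x) < e"
    using conv_approx[of "(\<lambda>ws. iter_deriv ws F) ` W" "2 *\<^sub>R a" "box
        (- a) a" e] \<open>finite W\<close> Ck a e by auto
  have qc: "continuous_on UNIV q"
    using q(1) continuous_on_polymonial_function real_polynomial_function_eq by blast
  obtain L where L: "\<forall>(p, c)\<in>set L. real_polynomial_function p"
    "\<forall>x\<in>cbox (- a) a. conv (2 *\<^sub>R a) q F x = poly_comb L x"
    using conv_polynomial[OF q(1) Ck_continuous_on[OF F] supp] by blast
  have "norm (iter_deriv ws (poly_comb L) x - iter_deriv ws F x) < e"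
      if ws: "ws \<in> W" and x: "x \<in> box (- a) a" for ws x
  proof -
    \<comment> \<open>The two functions agree on the closed box; equality of derivatives needs an
      open set, hence the open box in the conclusion.\<close>
    have "iter_deriv ws (poly_comb L) x = iter_deriv ws (conv (2 *\<^sub>R a) q F) x"
      by (rule iter_deriv_cong[OF open_box _ x]) (metis L(2) box_subset_cbox subsetD)
    also have "\<dots> = conv (2 *\<^sub>R a) q (iter_deriv ws F) x"
      using iter_deriv_conv[OF qc Ck(1)[OF ws]] by simp
    finally show ?thesis using q(2) ws x by simp
  qed
  then show ?thesis using L(1) unfolding W_def by blast
qed

section \<open>Extension and change of coordinates\<close>

lemma Ck_Un:
  assumes "open U" "open V" "Ck k U f" "Ck k V f" shows "Ck k (U \<union> V) f"
  using assms(3,4) by (induction k arbitrary: f) (auto intro: continuous_on_open_Un assms(1,2))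

text \<open>A local extension is multiplied by a truncated power that vanishes outside a ball inside
  \<open>W\<close>, and then continued by 0. The exponent \<open>Suc k\<close> is what
  \<open>Ck_max_power\<close> asks for.\<close>

lemma smooth_on_set_bump:
  fixes f :: "'a::euclidean_space \<Rightarrow> 'b::real_normed_vector"
  assumes "smooth_on_set M f" "x \<in> M"
  shows "\<exists>(\<beta> :: 'a \<Rightarrow> real) G. Ck k UNIV \<beta> \<and>
      (\<forall>y. 0 \<le> \<beta> y) \<and> 0 < \<beta> x \<and> Ck k UNIV G \<and>
    (\<forall>y\<in>M. G y = \<beta> y *\<^sub>R f y) \<and> bounded {y. G y \<noteq> 0}"
proof -
  obtain W F where W: "x \<in> W" "smooth_on_open W F" "\<forall>y\<in>M \<inter> W. F y = f y"
    using assms unfolding smooth_on_set_def by blast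
  have "open W" using W unfolding smooth_on_open_def by blast
  then obtain r where r: "r > 0" "cball x r \<subseteq> W" using W(1) open_contains_cball by blast
  define \<beta> where "\<beta> y = max 0 (r\<^sup>2 - (y - x) \<bullet> (y - x)) ^ Suc k" for y
  define G where "G y = (if y \<in> ball x r then \<beta> y *\<^sub>R F y else 0)" for y
  have Ck\<beta>: "Ck k U \<beta>" if "open U" for U
    unfolding \<beta>_def[abs_def]
    by (intro Ck_max_power that Ck_diff Ck_const Ck_inner Ck_id) simp
  have \<beta>0: "\<beta> y = 0" if "y \<notin> ball x r" for y
  proof -
    have "r\<^sup>2 \<le> (norm (y - x))\<^sup>2" using that r
        by (intro power_mono) (auto simp: dist_norm norm_minus_commute)
    then show ?thesis by (simp add: \<beta>_def dot_square_norm)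
  qed
  have "Ck k W (\<lambda>y. \<beta> y *\<^sub>R F y)"
    by (intro Ck_scaleR Ck\<beta> \<open>open W\<close> smooth_on_open_imp_Ck W)
  moreover have "G y = \<beta> y *\<^sub>R F y" for y using \<beta>0 by (simp add: G_def)
  ultimately have 1: "Ck k W G" by (simp cong: Ck_cong[OF \<open>open W\<close>])
  have 2: "Ck k (- cball x r) G"
    using Ck_cong[of "- cball x r" G "\<lambda>_. 0" k] Ck_const[of "- cball x r"]
        by (auto simp: G_def open_Compl)
  have "W \<union> - cball x r = UNIV" using r by auto
  then have "Ck k UNIV G" using Ck_Un[OF \<open>open W\<close> _ 1 2] by (simp add: open_Compl)
  moreover have "G y = \<beta> y *\<^sub>R f y" if "y \<in> M" for y
    using that r(2) W(3) \<beta>0 by (cases "y \<in> ball x r") (auto simp: G_def subset_iff)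
  moreover have "bounded {y. G y \<noteq> 0}"
    by (rule bounded_subset[OF bounded_ball[of x r]]) (auto simp: G_def)
  moreover have "0 < \<beta> x" using r by (simp add: \<beta>_def)
  moreover have "0 \<le> \<beta> y" for y by (simp add: \<beta>_def)
  ultimately show ?thesis using Ck\<beta>[OF open_UNIV] by blast
qed

text \<open>Only finite differentiability of the extension is needed, so truncated powers replace
  smooth bump functions.  The sum \<open>S\<close> of the bumps is at least \<open>c > 0\<close> on
      \<open>M\<close>, and adding
  \<open>max 0 (c - S) ^ Suc k\<close> makes it positive everywhere without changing it on
      \<open>M\<close>.\<close>

lemma smooth_on_set_extension:
  fixes f :: "'a::euclidean_space \<Rightarrow> 'b::real_normed_vector"
  assumes "compact M" "smooth_on_set M f"
  shows "\<exists>F. Ck k UNIV F \<and> (\<forall>x\<in>M. F x = f x) \<and> bounded {x. F x \<noteq> 0}"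
proof (cases "M = {}")
  case True
  then show ?thesis by (intro exI[of _ "\<lambda>_. 0"]) (simp add: Ck_const)
next
  case False
  have "\<forall>x\<in>M. \<exists>\<beta>G. Ck k UNIV (fst \<beta>G) \<and>
      (\<forall>y. 0 \<le> fst \<beta>G y) \<and> 0 < fst \<beta>G x \<and> Ck k UNIV (snd \<beta>G) \<and>
    (\<forall>y\<in>M. snd \<beta>G y = fst \<beta>G y *\<^sub>R f y) \<and>
        bounded {y. snd \<beta>G y \<noteq> 0}"
    using smooth_on_set_bump[OF assms(2), of _ k] by simp
  then obtain h where h: "\<And>x. x \<in> M \<Longrightarrow> Ck k UNIV (fst (h x)) \<and>
      (\<forall>y. 0 \<le> fst (h x) y) \<and> 0 < fst (h x) x \<and>
    Ck k UNIV (snd (h x)) \<and> (\<forall>y\<in>M. snd (h x) y = fst (h x) y *\<^sub>R f y) \<and>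
        bounded {y. snd (h x) y \<noteq> 0}"
    by metis
  define \<beta> G where "\<beta> x = fst (h x)" and "G x = snd (h x)" for x
  note h = h[folded \<beta>_def G_def]
  have "open {y. 0 < \<beta> x y}" if "x \<in> M" for x
    using h[OF that] by (intro open_Collect_less continuous_on_const) (auto intro: Ck_continuous_on)
  moreover have "M \<subseteq> (\<Union>x\<in>M. {y. 0 < \<beta> x y})" using h by blast
  ultimately obtain C where C: "C \<subseteq> M" "finite C" "M \<subseteq>
      (\<Union>x\<in>C. {y. 0 < \<beta> x y})"
    by (rule compactE_image[OF assms(1)])
  define S where "S y = (\<Sum>x\<in>C. \<beta> x y)" for y
  define T where "T y = (\<Sum>x\<in>C. G x y)" for y
  have S: "Ck k UNIV S" and T: "Ck k UNIV T"
    unfolding S_def[abs_def] T_def[abs_def] using h C by (auto intro!: Ck_sum)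
  have S0: "0 \<le> S y" for y unfolding S_def using h C by (auto intro!: sum_nonneg)
  have Spos: "0 < S y" if y: "y \<in> M" for y
  proof -
    obtain x where "x \<in> C" "0 < \<beta> x y" using C(3) y by blast
    then show ?thesis unfolding S_def using C h by (intro sum_pos2[of C x]) auto
  qed
  have TS: "T y = S y *\<^sub>R f y" if "y \<in> M" for y
    unfolding T_def S_def scaleR_sum_left using h C that by (intro sum.cong) auto
  \<comment> \<open>\<open>S y0\<close> is the positive lower bound of \<open>S\<close> on
    \<open>M\<close>, attained by compactness.\<close>
  obtain y0 where y0: "y0 \<in> M" "\<And>y. y \<in> M \<Longrightarrow> S y0 \<le> S y"
    using continuous_attains_inf[OF assms(1) False, of S] Ck_continuous_on[OF S] continuous_on_subset by blast
  define D where "D y = S y + max 0 (S y0 - S y) ^ Suc k" for y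
  have D: "Ck k UNIV D"
    unfolding D_def[abs_def] by (intro Ck_add Ck_max_power Ck_diff Ck_const S) auto
  have Dpos: "D y > 0" for y
    using S0[of y] Spos[OF y0(1)] unfolding D_def
    by (cases "S y0 \<le> S y") (auto intro!: add_nonneg_pos)
  define F where "F y = inverse (D y) *\<^sub>R T y" for y
  have "Ck k UNIV F"
    unfolding F_def[abs_def] using Dpos by (intro Ck_scaleR Ck_inverse D T) (auto simp: less_imp_neq[symmetric])
  moreover have "F y = f y" if "y \<in> M" for y
    using Spos[OF that] y0(2)[OF that] TS[OF that] by (simp add: F_def D_def)
  moreover have "bounded {y. F y \<noteq> 0}"
  proof -
    have "{y. F y \<noteq> 0} \<subseteq> (\<Union>x\<in>C. {y. G x y \<noteq> 0})"
      by (auto simp: F_def T_def intro: ccontr)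
    moreover have "bounded (\<Union>x\<in>C. {y. G x y \<noteq> 0})"
      using C(1,2) h by (intro bounded_UN) blast+
    ultimately show ?thesis by (rule bounded_subset[rotated])
  qed
  ultimately show ?thesis by blast
qed

text \<open>Expanding the chain rule in \<open>Basis\<close> shows the derivative of a composition
  as a sum of scalar functions times compositions with \<open>\<phi>\<close>, so inductions on the
  order close.\<close>

lemma has_derivative_compose_Basis:
  fixes G :: "'a::euclidean_space \<Rightarrow>
      'b::real_normed_vector" and \<phi> :: "'d::real_normed_vector \<Rightarrow> 'a"
  assumes "Ck (Suc k) UNIV G" "Ck (Suc j) U \<phi>" "u \<in> U"
  shows "((\<lambda>u. G (\<phi> u)) has_derivative
    (\<lambda>v. \<Sum>b\<in>Basis. (frechet_derivative \<phi>
        (at u) v \<bullet> b) *\<^sub>R frechet_derivative G (at (\<phi> u)) b)) (at u)"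
proof -
  note dG = Ck_has_derivative[OF assms(1) UNIV_I, of "\<phi> u"]
  have "frechet_derivative G (at (\<phi> u)) w =
      (\<Sum>b\<in>Basis. (w \<bullet> b) *\<^sub>R frechet_derivative G (at (\<phi> u)) b)" for w
  proof -
    have "linear (frechet_derivative G (at (\<phi> u)))"
      using dG by (rule has_derivative_linear)
    then show ?thesis
      by (subst (1) euclidean_representation[of w, symmetric]) (simp add: linear_sum linear_cmul)
  qed
  from this[of "frechet_derivative \<phi> (at u) _"] show ?thesis
    by (rule has_derivative_eq_rhs[OF has_derivative_compose[OF Ck_has_derivative[OF assms(2,3)] dG] ext])
qed

lemma Ck_compose:
  fixes G :: "'a::euclidean_space \<Rightarrow>
      'b::real_normed_vector" and \<phi> :: "'d::real_normed_vector \<Rightarrow> 'a"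
  assumes "open U" "Ck k UNIV G" "Ck k U \<phi>" shows "Ck k U (\<lambda>u. G (\<phi> u))"
  using assms(2,3)
proof (induction k arbitrary: G)
  case 0
  then show ?case by (auto intro: continuous_on_compose2)
next
  case (Suc k)
  show ?case
  proof (rule Ck_SucI[OF assms(1) has_derivative_compose_Basis[OF Suc.prems]])
    show "Ck k U (\<lambda>u. \<Sum>b\<in>Basis. (frechet_derivative \<phi>
        (at u) v \<bullet> b) *\<^sub>R frechet_derivative G (at (\<phi> u)) b)" for v
      by (intro Ck_sum Ck_scaleR Ck_inner Ck_const assms(1) Suc.IH Suc.prems[THEN Ck_frechet_derivative]
          Suc.prems[THEN Ck_Suc_imp])
  qed
qed

text \<open>\<open>C\<close> is chosen before \<open>G\<close>: this uniformity transfers closeness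
  of ambient derivatives to charts. The weight \<open>c\<close> serves the induction, as the product
  and chain rules yield terms of the same shape with new weights \<open>c0\<close> and
  \<open>cb b\<close>.\<close>

lemma iter_deriv_compose_bound:
  fixes \<phi> :: "'d::euclidean_space \<Rightarrow> 'a::euclidean_space"
  assumes U: "open U" and \<phi>: "\<And>k. Ck k U \<phi>" and K: "compact K" "K \<subseteq> U"
    and c: "\<And>k. Ck k U (c :: 'd \<Rightarrow> real)"
  shows "\<exists>C\<ge>0. \<forall>(G :: 'a \<Rightarrow>
      'b::real_normed_vector) B. Ck (length vs) UNIV G \<longrightarrow> 0 \<le> B \<longrightarrow>
    (\<forall>ws. length ws \<le> length vs \<longrightarrow> set ws \<subseteq> Basis \<longrightarrow>
        (\<forall>u\<in>K. norm (iter_deriv ws G (\<phi> u)) \<le> B)) \<longrightarrow>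
    (\<forall>u\<in>K. norm (iter_deriv vs (\<lambda>u. c u *\<^sub>R G (\<phi> u)) u) \<le> C * B)"
  using c
proof (induction vs arbitrary: c rule: rev_induct)
  case Nil
  have "bounded (c ` K)"
    using K Ck_continuous_on[OF Nil.prems[of 0]]
    by (intro compact_imp_bounded compact_continuous_image) (auto intro: continuous_on_subset)
  then obtain C where C: "C > 0" "\<forall>u\<in>K. norm (c u) \<le> C" unfolding bounded_pos by auto
  show ?case
  proof (intro exI[of _ C] conjI allI impI ballI)
    fix G :: "'a \<Rightarrow> 'b" and B u
    assume "\<forall>ws. length ws \<le> length [] \<longrightarrow>
        set ws \<subseteq> Basis \<longrightarrow>
        (\<forall>u\<in>K. norm (iter_deriv ws G (\<phi> u)) \<le> B)"
      and "u \<in> K"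
    then have "norm (iter_deriv [] G (\<phi> u)) \<le> B" by fastforce
    then show "norm (iter_deriv [] (\<lambda>u. c u *\<^sub>R G (\<phi> u)) u) \<le> C * B"
      using C \<open>u \<in> K\<close> by (auto intro!: mult_mono)
  qed (use C in simp)
next
  case (snoc v vs)
  let ?P = "\<lambda>c C. C \<ge> 0 \<and>
      (\<forall>(G :: 'a \<Rightarrow> 'b) B. Ck (length vs) UNIV G \<longrightarrow>
      0 \<le> B \<longrightarrow>
    (\<forall>ws. length ws \<le> length vs \<longrightarrow> set ws \<subseteq> Basis \<longrightarrow>
        (\<forall>u\<in>K. norm (iter_deriv ws G (\<phi> u)) \<le> B)) \<longrightarrow>
    (\<forall>u\<in>K. norm (iter_deriv vs (\<lambda>u. c u *\<^sub>R G (\<phi> u)) u) \<le> C * B))"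
  define c0 where "c0 u = frechet_derivative c (at u) v" for u
  define cb where "cb b u = c u * (frechet_derivative \<phi> (at u) v \<bullet> b)" for b u
  have c0: "Ck k U c0" for k
    unfolding c0_def[abs_def] using snoc.prems by (rule Ck_frechet_derivative)
  have cb: "Ck k U (cb b)" for k b
    unfolding cb_def[abs_def] by (intro Ck_mult Ck_inner Ck_const U snoc.prems \<phi>[THEN
        Ck_frechet_derivative])
  obtain C0 where C0: "?P c0 C0" using snoc.IH[OF c0] by blast
  have "?P (cb b) (SOME C. ?P (cb b) C)" for b
    by (rule someI_ex[OF snoc.IH[OF cb]])
  then obtain Cb where Cb: "\<And>b. ?P (cb b) (Cb b)" by (rule that)
  show ?case
  proof (intro exI[of _ "C0 + (\<Sum>b\<in>Basis. Cb b)"] conjI allI impI ballI)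
    show "0 \<le> C0 + (\<Sum>b\<in>Basis. Cb b)" using C0 Cb by (auto intro!: add_nonneg_nonneg sum_nonneg)
  next
    fix G :: "'a \<Rightarrow> 'b" and B u
    assume G: "Ck (length (vs @ [v])) UNIV G" and B: "0 \<le> B" and u: "u \<in> K"
      and bd: "\<forall>ws. length ws \<le> length (vs @ [v]) \<longrightarrow>
          set ws \<subseteq> Basis \<longrightarrow>
          (\<forall>u\<in>K. norm (iter_deriv ws G (\<phi> u)) \<le> B)"
    have G': "Ck (Suc (length vs)) UNIV G" using G by (simp del: Ck.simps)
    define Gb where "Gb b y = frechet_derivative G (at y) b" for b y
    have Gb: "Ck (length vs) UNIV (Gb b)" for b
      unfolding Gb_def[abs_def] using G' by (rule Ck_frechet_derivative)
    have comp: "Ck (length vs) U (\<lambda>u. c0 u *\<^sub>R G (\<phi> u))" "Ck (length vs) U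
        (\<lambda>u. cb b u *\<^sub>R Gb b (\<phi> u))" for b
      using Ck_scaleR[OF U c0 Ck_compose[OF U G'[THEN Ck_Suc_imp] \<phi>]] Ck_scaleR[OF U cb
          Ck_compose[OF U Gb \<phi>]]
      by blast+
    have d: "frechet_derivative (\<lambda>u. c u *\<^sub>R G (\<phi> u)) (at w) v =
        c0 w *\<^sub>R G (\<phi> w) + (\<Sum>b\<in>Basis. cb b w *\<^sub>R Gb b (\<phi> w))"
            if "w \<in> U" for w
    proof -
      note has_derivative_scaleR[OF Ck_has_derivative[OF snoc.prems that]
          has_derivative_compose_Basis[OF G' \<phi> that]]
      from frechet_derivative_at[OF this, symmetric] show ?thesis
        by (simp add: c0_def cb_def Gb_def scaleR_sum_right add.commute)
    qed
    have uU: "u \<in> U" using u K by blast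
    have "iter_deriv (vs @ [v]) (\<lambda>u. c u *\<^sub>R G (\<phi> u)) u =
        iter_deriv vs (\<lambda>w. c0 w *\<^sub>R G (\<phi> w) +
            (\<Sum>b\<in>Basis. cb b w *\<^sub>R Gb b (\<phi> w))) u"
      unfolding iter_deriv_append by (rule iter_deriv_cong[OF U _ uU]) (simp add: d)
    also have "\<dots> = iter_deriv vs (\<lambda>w. c0 w *\<^sub>R G (\<phi> w)) u +
        (\<Sum>b\<in>Basis. iter_deriv vs (\<lambda>w. cb b w *\<^sub>R Gb b (\<phi> w)) u)"
      by (subst iter_deriv_add[OF U comp(1) Ck_sum[OF U comp(2)] uU])
        (simp add: iter_deriv_sum[OF U finite_Basis comp(2) uU])
    finally have eq: "iter_deriv (vs @ [v]) (\<lambda>u. c u *\<^sub>R G (\<phi> u)) u = \<dots>" .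
    have "norm (iter_deriv vs (\<lambda>w. c0 w *\<^sub>R G (\<phi> w)) u) \<le> C0 * B"
      using C0 G'[THEN Ck_Suc_imp] B bd u by (auto simp del: Ck.simps)
    moreover have "norm (iter_deriv vs (\<lambda>w. cb b w *\<^sub>R Gb b (\<phi> w)) u) \<le> Cb b * B"
        if "b \<in> Basis" for b
    proof -
      \<comment> \<open>Deriving \<open>Gb b\<close> along \<open>ws\<close> is deriving
        \<open>G\<close> along \<open>ws @ [b]\<close>, a word one longer that \<open>bd\<close>
        still covers.\<close>
      have "norm (iter_deriv ws (Gb b) (\<phi> u)) \<le> B"
          if "length ws \<le> length vs" "set ws \<subseteq> Basis" "u \<in> K" for ws u
        using bd[rule_format, of "ws @ [b]" u] that \<open>b \<in> Basis\<close>
            by (simp add: iter_deriv_append Gb_def[abs_def])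
      then show ?thesis using Cb[of b] Gb[of b] B u by blast
    qed
    then have "norm (\<Sum>b\<in>Basis. iter_deriv vs (\<lambda>w. cb b w *\<^sub>R Gb b
        (\<phi> w)) u) \<le> (\<Sum>b\<in>Basis. Cb b * B)"
      by (rule sum_norm_le)
    ultimately show "norm (iter_deriv (vs @ [v]) (\<lambda>u. c u *\<^sub>R G (\<phi> u)) u) \<le> (C0 +
        (\<Sum>b\<in>Basis. Cb b)) * B"
      unfolding eq distrib_right sum_distrib_right by (rule norm_triangle_mono)
  qed
qed

section \<open>Density of the polynomials\<close>

definition ocoord_funs :: "(octonion \<Rightarrow> real) list" where
  "ocoord_funs =
    [Re \<circ> fst \<circ> fst, Im \<circ> fst \<circ> fst, Re \<circ> snd \<circ> fst,
        Im \<circ> snd \<circ> fst,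
     Re \<circ> fst \<circ> snd, Im \<circ> fst \<circ> snd, Re \<circ> snd \<circ> snd,
         Im \<circ> snd \<circ> snd]"

text \<open>A list of functions, in contrast to the list of values in \<open>jcoord\<close>:
  linearity and the comparison with \<open>Basis\<close> become statements about its
  members.\<close>

definition jcoord_funs :: "(jordan \<Rightarrow> real) list" where
  "jcoord_funs =
     map (\<lambda>f. f \<circ> fst) ocoord_funs @ map (\<lambda>f. f \<circ> fst \<circ> snd) ocoord_funs @
     map (\<lambda>f. f \<circ> fst \<circ> snd \<circ> snd) ocoord_funs @
     [fst \<circ> snd \<circ> snd \<circ> snd, fst \<circ> snd \<circ> snd \<circ> snd \<circ> snd,
         snd \<circ> snd \<circ> snd \<circ> snd \<circ> snd]"

lemma length_jcoord_funs: "length jcoord_funs = 27"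
  by (simp add: jcoord_funs_def ocoord_funs_def)

lemma jcoord_index: "i \<in> {1..27} \<Longrightarrow> i - 1 < length jcoord_funs"
  unfolding length_jcoord_funs by auto

lemma jcoord_eq_nth:
  assumes "i \<in> {1..27}" shows "jcoord i = jcoord_funs ! (i - 1)"
proof
  fix A
  have "jcoord i A = map (\<lambda>f. f A) jcoord_funs ! (i - 1)"
    by (simp add: jcoord_def jcoord_funs_def ocoord_funs_def ocoords_def split_beta)
  then show "jcoord i A = (jcoord_funs ! (i - 1)) A"
    using nth_map[OF jcoord_index[OF assms], of "\<lambda>f. f A"] by simp
qed

lemma bounded_linear_jcoord:
  assumes "i \<in> {1..27}" shows "bounded_linear (jcoord i)"
proof -
  have "\<forall>f\<in>set jcoord_funs. linear f"
    by (auto simp: jcoord_funs_def ocoord_funs_def intro!: linearI)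
  then show ?thesis
    using jcoord_eq_nth[OF assms] nth_mem[OF jcoord_index[OF assms]]
    by (simp add: linear_conv_bounded_linear[symmetric])
qed

lemma mem_Basis_prod_iff:
  "b \<in> (Basis :: ('a::euclidean_space \<times> 'b::euclidean_space) set) \<longleftrightarrow>
    (\<exists>c. c \<in> Basis \<and> b = (c, 0)) \<or> (\<exists>c. c \<in> Basis \<and> b = (0, c))"
  by (auto simp: Basis_prod_def)

text \<open>The bridge from the library basis to the 27 variables: a linear functional is determined
  by its values on \<open>Basis\<close>, so it becomes a combination of coordinates.\<close>

lemma Basis_jcoord:
  assumes "b \<in> (Basis :: jordan set)" shows "\<exists>i\<in>{1..27}. \<forall>A. A \<bullet> b = jcoord i A"
proof -
  have 1: "(\<lambda>x. x \<bullet> c) \<in> set ocoord_funs" if "c \<in> (Basis :: octonion set)" for c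
    using that by (auto simp: ocoord_funs_def Basis_prod_def Basis_complex_def inner_prod_def fun_eq_iff)
  have "(\<lambda>A. A \<bullet> b) \<in> set jcoord_funs"
  proof -
    consider (z) c where "c \<in> Basis" "b = (c, 0)" | (y) c where "c \<in> Basis" "b = (0, c, 0)"
      | (x) c where "c \<in> Basis" "b = (0, 0, c, 0)"
      | (r) "b = (0, 0, 0, 1, 0) \<or> b = (0, 0, 0, 0, 1, 0) \<or> b = (0, 0, 0, 0, 0, 1)"
      using assms
      unfolding mem_Basis_prod_iff[where 'a = octonion and 'b =
          "octonion \<times> octonion \<times> real \<times> real \<times> real"]
        mem_Basis_prod_iff[where 'a = octonion and 'b = "octonion \<times> real \<times> real \<times> real"]
        mem_Basis_prod_iff[where 'a = octonion and 'b = "real \<times> real \<times> real"]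
        mem_Basis_prod_iff[where 'a = real] Basis_real_def
      by blast
    then show ?thesis
    proof cases
      case z
      then have "(\<lambda>A. A \<bullet> b) = (\<lambda>x. x \<bullet> c) \<circ> fst"
          by (auto simp: fun_eq_iff)
      then show ?thesis using 1[OF z(1)] by (simp add: jcoord_funs_def)
    next
      case y
      then have "(\<lambda>A. A \<bullet> b) = (\<lambda>x. x \<bullet> c) \<circ> fst \<circ> snd"
          by (auto simp: fun_eq_iff)
      then show ?thesis using 1[OF y(1)] by (simp add: jcoord_funs_def)
    next
      case x
      then have "(\<lambda>A. A \<bullet> b) =
          (\<lambda>x. x \<bullet> c) \<circ> fst \<circ> snd \<circ> snd" by (auto simp: fun_eq_iff)
      then show ?thesis using 1[OF x(1)] by (simp add: jcoord_funs_def)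
    next
      case r
      then show ?thesis by (auto simp: jcoord_funs_def fun_eq_iff inner_prod_def)
    qed
  qed
  then obtain n where "n < 27" "jcoord_funs ! n = (\<lambda>A. A \<bullet> b)"
    by (auto simp: in_set_conv_nth length_jcoord_funs)
  then show ?thesis
    by (intro bexI[of _ "Suc n"] allI) (simp_all add: jcoord_eq_nth)
qed

lemma Ck_peval: "Ck k UNIV (peval Q)"
proof -
  have "Ck k UNIV (\<lambda>A. complex_of_real (jcoord i A))" if "i \<in> {1..27}" for i
    by (intro Ck_bounded_linear[OF bounded_linear_compose[OF bounded_linear_of_real
        bounded_linear_jcoord[OF that]]] Ck_id open_UNIV)
  then show ?thesis unfolding peval_def[abs_def]
    by (intro Ck_sum Ck_mult Ck_const Ck_prod Ck_power open_UNIV)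
qed

lemma peval_const: "\<exists>Q\<in>allpoly. \<forall>A. peval Q A = c"
proof
  have "Poly_Mapping.single 0 c \<in> hompoly 0" by (auto simp: hompoly_def)
  then show "Poly_Mapping.single 0 c \<in> allpoly" using hompoly_allpoly by blast
  show "\<forall>A. peval (Poly_Mapping.single 0 c) A = c" by (simp add: peval_single)
qed

lemma allpoly_mult:
  assumes "P \<in> allpoly" "Q \<in> allpoly" shows "P * Q \<in> allpoly"
proof -
  have cm: "cscale c P * Q = cscale c (P * Q)" "P * cscale c Q = cscale c (P * Q)" for c P Q
    by (simp_all add: cscale_def ac_simps)
  have 1: "P * Q \<in> allpoly" if P: "P \<in> hompoly i" and "Q \<in> allpoly" for P Q i
    using that(2) unfolding allpoly_def
  proof (induction Q rule: cpoly.span_induct)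
    show "cpoly.subspace {Q. P * Q \<in> cpoly_span (\<Union>k. hompoly k)}"
      by (rule cpoly.subspaceI) (auto simp: cm distrib_left intro: cpoly.span_add cpoly.span_scale
          cpoly.span_zero)
    show "P * Q \<in> cpoly_span (\<Union>k. hompoly k)" if "Q \<in> (\<Union>k. hompoly k)" for Q
      using that hompoly_mult[OF P] by (auto intro!: cpoly.span_base)
  qed
  show ?thesis
    using assms(1) unfolding allpoly_def
  proof (induction P rule: cpoly.span_induct)
    show "cpoly.subspace {P. P * Q \<in> cpoly_span (\<Union>k. hompoly k)}"
      by (rule cpoly.subspaceI) (auto simp: cm distrib_right intro: cpoly.span_add cpoly.span_scale
          cpoly.span_zero)
    show "P * Q \<in> cpoly_span (\<Union>k. hompoly k)" if "P \<in> (\<Union>k. hompoly k)" for P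
      using that 1[OF _ assms(2)] unfolding allpoly_def by blast
  qed
qed

lemma peval_jcoord:
  assumes "i \<in> {1..27}" shows "\<exists>Q\<in>allpoly. \<forall>A. peval Q A = complex_of_real (jcoord i A)"
proof
  let ?Q = "Poly_Mapping.single (Poly_Mapping.single i 1) (1 :: complex)"
  have "?Q \<in> hompoly 1" using assms by (auto simp: hompoly_def lookup_single when_def)
  then show "?Q \<in> allpoly" using hompoly_allpoly by blast
  have "mono_val (Poly_Mapping.single i 1) A = complex_of_real (jcoord i A)" for A
  proof -
    have "mono_val (Poly_Mapping.single i 1) A = (\<Prod>j=1..27.
        if j = i then complex_of_real (jcoord j A) else 1)"
      unfolding mono_val_def by (intro prod.cong) (auto simp: lookup_single when_def)
    then show ?thesis using assms by simp
  qed
  then show "\<forall>A. peval ?Q A = complex_of_real (jcoord i A)" by (simp add: peval_single)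
qed

lemma real_polynomial_function_peval:
  assumes "real_polynomial_function (p :: jordan \<Rightarrow> real)"
  shows "\<exists>Q\<in>allpoly. \<forall>A. peval Q A = complex_of_real (p A)"
  using assms
proof (induction p rule: real_polynomial_function.induct)
  case (linear l)
  obtain i where i: "\<And>b. b \<in> (Basis :: jordan set) \<Longrightarrow> i b \<in> {1..27}"
    "\<And>b A. b \<in> (Basis :: jordan set) \<Longrightarrow> A \<bullet> b = jcoord (i b) A"
    using Basis_jcoord by metis
  obtain Q where Q: "\<And>j. j \<in> {1..27} \<Longrightarrow> Q j \<in> allpoly"
    "\<And>j A. j \<in> {1..27} \<Longrightarrow> peval (Q j) A = complex_of_real (jcoord j A)"
    using peval_jcoord by metis
  let ?P = "\<Sum>b\<in>Basis. cscale (complex_of_real (l b)) (Q (i b))"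
  have "?P \<in> allpoly"
    using i Q by (intro cpoly.subspace_sum[OF subspace_allpoly] cpoly.subspace_scale[OF subspace_allpoly]) auto
  moreover have "peval ?P A = complex_of_real (l A)" for A
  proof -
    have "l A = (\<Sum>b\<in>Basis. (A \<bullet> b) * l b)"
      using linear by (subst (1) euclidean_representation[of A, symmetric])
        (simp add: linear_sum linear_cmul bounded_linear.linear)
    then show ?thesis using i Q by (simp add: peval_sum peval_cscale mult.commute)
  qed
  ultimately show ?case by blast
next
  case (const c)
  then show ?case by (rule peval_const)
next
  case (add f g)
  then show ?case using cpoly.subspace_add[OF subspace_allpoly] by (metis peval_add of_real_add)
next
  case (mult f g)
  then show ?case using allpoly_mult by (metis peval_mult of_real_mult)
qed

lemma poly_comb_peval:
  assumes "\<forall>(p, c)\<in>set L. real_polynomial_function (p :: jordan \<Rightarrow> real)"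
  shows "\<exists>Q\<in>allpoly. \<forall>A. peval Q A = poly_comb L A"
  using assms
proof (induction L)
  case Nil
  then show ?case using peval_const[of 0] by (simp add: poly_comb_def)
next
  case (Cons u L)
  obtain p c where u: "u = (p, c)" by fastforce
  obtain P where P: "P \<in> allpoly" "\<And>A. peval P A = complex_of_real (p A)"
    using real_polynomial_function_peval[of p] Cons.prems by (auto simp: u)
  obtain Q where Q: "Q \<in> allpoly" "\<And>A. peval Q A = poly_comb L A"
    using Cons by auto
  have "cscale c P + Q \<in> allpoly"
    by (intro cpoly.subspace_add[OF subspace_allpoly] cpoly.subspace_scale[OF subspace_allpoly] P Q)
  then show ?case
    by (rule bexI[rotated]) (simp add: peval_add peval_cscale P Q poly_comb_def u scaleR_conv_of_real
        mult.commute)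
qed

section \<open>Compactness of the projective plane\<close>

lemma bilinear_jprod: "bilinear jprod"
proof -
  have comm: "A \<bullet>\<^sub>J B = B \<bullet>\<^sub>J A" for A B
    by (simp add: jprod_jread add.commute)
  have lin: "linear (\<lambda>A. A \<bullet>\<^sub>J B)" for B
  proof (rule linearI)
    obtain z y x a b c where B: "B = (z, y, x, a, b, c)" by (metis surj_pair)
    fix A A' :: jordan and r :: real
    obtain z1 y1 x1 a1 b1 c1 where A: "A = (z1, y1, x1, a1, b1, c1)" by (metis surj_pair)
    obtain z2 y2 x2 a2 b2 c2 where A': "A' = (z2, y2, x2, a2, b2, c2)" by (metis surj_pair)
    show "(A + A') \<bullet>\<^sub>J B = A \<bullet>\<^sub>J B + A' \<bullet>\<^sub>J B"
      by (simp add: A A' B jprod_eq omult_bilinear_simps oconj_add algebra_simps)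
    show "(r *\<^sub>R A) \<bullet>\<^sub>J B = r *\<^sub>R (A \<bullet>\<^sub>J B)"
      by (simp add: A B jprod_eq omult_bilinear_simps oconj_scaleR algebra_simps)
  qed
  then show ?thesis unfolding bilinear_def by (simp add: comm[of _ "_ :: jordan"])
qed

text \<open>Closed by continuity of the defining equations. Bounded because the diagonal entries are
  nonnegative with sum 1 and the squared norms of the octonions are products of them.\<close>

lemma compact_P2O: "compact P2O"
proof -
  have "continuous_on UNIV (\<lambda>X. X \<bullet>\<^sub>J X)"
    by (rule bilinear_continuous_on_compose[OF continuous_on_id continuous_on_id bilinear_jprod])
  moreover have "continuous_on UNIV jtrace"
    unfolding jtrace_def split_beta by (intro continuous_intros)
  ultimately have "closed ({X. X \<bullet>\<^sub>J X = X} \<inter> {X. jtrace X = 1})"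
    by (intro closed_Int closed_Collect_eq continuous_intros)
  moreover have "P2O = {X. X \<bullet>\<^sub>J X = X} \<inter> {X. jtrace X = 1}"
    by (auto simp: mem_P2O_iff)
  ultimately have "closed P2O" by simp
  moreover have "P2O \<subseteq> cball 0 1 \<times> cball 0 1 \<times> cball 0 1 \<times> {0..1}
      \<times> {0..1} \<times> {0..1}"
  proof
    fix X assume X: "X \<in> P2O"
    obtain z y x a b c where eq: "X = (z, y, x, a, b, c)" by (metis surj_pair)
    note rel = P2O_relations[OF X[unfolded eq]]
    have "norm w \<le> 1" if "w \<bullet> w = s * t" "0 \<le> s" "0 \<le> t" "s \<le> 1" "t \<le> 1"
        for s t and w :: octonion
    proof -
      have "(norm w)\<^sup>2 \<le> 1\<^sup>2" using that by (simp add: mult_le_one flip: dot_square_norm)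
      then show ?thesis by (rule power2_le_imp_le) simp
    qed
    from this[OF rel(2)[symmetric]] this[OF rel(3)[symmetric]] this[OF rel(4)[symmetric]]
    show "X \<in> cball 0 1 \<times> cball 0 1 \<times> cball 0 1 \<times> {0..1} \<times> {0..1}
        \<times> {0..1}"
      using rel(1,5-) by (simp add: eq)
  qed
  then have "bounded P2O"
    by (rule bounded_subset[rotated]) (intro bounded_Times bounded_cball bounded_closed_interval)
  ultimately show ?thesis by (simp add: compact_eq_bounded_closed)
qed

section \<open>Smooth neighbourhoods controlled by ambient derivatives\<close>

lemma restr_in_Cinf: "restr Q \<in> Cinf P2O"
proof -
  have "smooth_on_open UNIV (peval Q)" by (intro Ck_imp_smooth_on_open Ck_peval open_UNIV)
  then have "smooth_on_set P2O (restr Q)"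
    unfolding smooth_on_set_def restr_def by (intro ballI exI[of _ UNIV] exI[of _ "peval Q"]) auto
  then show ?thesis by (simp add: Cinf_def restr_def)
qed

text \<open>A function on \<open>M\<close> has no derivatives in ambient directions, so closeness is
  measured on some pair of ambient extensions. In the application the extension of the approximant
  is the polynomial itself.\<close>

definition Ck_close :: "'a::euclidean_space set \<Rightarrow> nat \<Rightarrow> real \<Rightarrow>
    ('a \<Rightarrow> complex) \<Rightarrow> ('a \<Rightarrow> complex) \<Rightarrow> bool" where
  "Ck_close M k e f g \<longleftrightarrow> (\<exists>F G. Ck k UNIV F \<and> Ck k UNIV G \<and>
      (\<forall>x\<in>M. F x = f x \<and> G x = g x) \<and>
    (\<forall>ws. length ws \<le> k \<longrightarrow> set ws \<subseteq> Basis \<longrightarrow>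
        (\<forall>x\<in>M. norm (iter_deriv ws G x - iter_deriv ws F x) < e)))"

lemma Ck_close_mono:
  assumes "Ck_close M k e f g" "j \<le> k" "e \<le> d" shows "Ck_close M j d f g"
proof -
  obtain F G where FG: "Ck k UNIV F" "Ck k UNIV G" "\<forall>x\<in>M. F x = f x \<and> G x = g x"
    "\<forall>ws. length ws \<le> k \<longrightarrow> set ws \<subseteq> Basis \<longrightarrow>
        (\<forall>x\<in>M. norm (iter_deriv ws G x - iter_deriv ws F x) < e)"
    using assms(1) unfolding Ck_close_def by blast
  have "Ck j UNIV F" "Ck j UNIV G" using FG(1,2) assms(2) by (auto intro: Ck_le)
  moreover have "norm (iter_deriv ws G x - iter_deriv ws F x) < d"
    if "length ws \<le> j" "set ws \<subseteq> Basis" "x \<in> M" for ws x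
  proof -
    have "norm (iter_deriv ws G x - iter_deriv ws F x) < e"
      using FG(4) that le_trans[OF that(1) assms(2)] by blast
    then show ?thesis using assms(3) by simp
  qed
  ultimately show ?thesis
    unfolding Ck_close_def using FG(3) by (intro exI[of _ F] exI[of _ G] conjI allI impI ballI) auto
qed

text \<open>A subbasic set is centred at \<open>f'\<close>, not at its member \<open>f\<close>. The
  strict bound on the compact set \<open>K\<close> leaves a margin, and the chain-rule bound keeps
  the change from \<open>f\<close> to \<open>g\<close> within it.\<close>

lemma Cinf_subbasic_Ck_nbhd:
  fixes M :: "'a::euclidean_space set" and \<phi> :: "'d::euclidean_space \<Rightarrow> 'a"
  assumes M: "compact M" and f: "f \<in> Cinf M" and f': "f' \<in> Cinf M"
    and \<phi>: "local_param M U \<phi>" and K: "compact K" "K \<subseteq> U"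
    and small: "\<forall>u\<in>K. norm (iter_deriv vs (\<lambda>w. f (\<phi> w) - f' (\<phi> w)) u) < e"
  shows "\<exists>d>0. \<forall>g. Ck_close M (length vs) d f g \<longrightarrow>
    (\<forall>u\<in>K. norm (iter_deriv vs (\<lambda>w. g (\<phi> w) - f' (\<phi> w)) u) < e)"
proof (cases "K = {}")
  case True
  then show ?thesis by (auto intro: exI[of _ 1])
next
  case False
  let ?k = "length vs"
  have sm: "smooth_on_open U \<phi>" and im: "\<phi> ` U \<subseteq> M"
    using \<phi> by (auto simp: local_param_def dest: openin_imp_subset)
  then have U: "open U" and Ck\<phi>: "\<And>k. Ck k U \<phi>"
    by (auto simp: smooth_on_open_def intro: smooth_on_open_imp_Ck)
  \<comment> \<open>\<open>H\<close> and \<open>H'\<close> are fixed before \<open>g\<close>, so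
    that the margin \<open>\<delta>\<close> does not depend on \<open>g\<close>. The later extension
    \<open>F\<close> of \<open>f\<close> may differ from \<open>H\<close> off \<open>M\<close>,
    which charts do not see.\<close>
  obtain H where H: "Ck ?k UNIV H" "\<forall>x\<in>M. H x = f x"
    using smooth_on_set_extension[OF M, of f ?k] f unfolding Cinf_def by blast
  obtain H' where H': "Ck ?k UNIV H'" "\<forall>x\<in>M. H' x = f' x"
    using smooth_on_set_extension[OF M, of f' ?k] f' unfolding Cinf_def by blast
  have CkD: "Ck ?k U (\<lambda>w. F (\<phi> w) - F' (\<phi> w))" if "Ck ?k UNIV F" "Ck ?k UNIV F'"
      for F F' :: "'a \<Rightarrow> complex"
    by (intro Ck_diff U Ck_compose[OF U _ Ck\<phi>] that)
  let ?h = "iter_deriv vs (\<lambda>w. H (\<phi> w) - H' (\<phi> w))"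
  have h: "iter_deriv vs (\<lambda>w. f (\<phi> w) - f' (\<phi> w)) u = ?h u" if "u \<in> U" for u
    using im H H' by (intro iter_deriv_cong[OF U _ that]) auto
  have "Ck 0 U ?h" using CkD[OF H(1) H'(1)] by (intro Ck_iter_deriv) simp
  then have "continuous_on K (\<lambda>u. norm (?h u))"
    using K by (auto intro: continuous_intros continuous_on_subset)
  then obtain u0 where u0: "u0 \<in> K" "\<And>u. u \<in> K \<Longrightarrow> norm (?h u) \<le> norm (?h u0)"
    using continuous_attains_sup[OF K(1) False] by blast
  define \<delta> where "\<delta> = e - norm (?h u0)"
  have \<delta>: "\<delta> > 0" using small u0(1) K h by (auto simp: \<delta>_def subset_iff)
  obtain C where C: "C \<ge> 0" "\<And>(G :: 'a \<Rightarrow>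
      complex) B u. Ck ?k UNIV G \<Longrightarrow> 0 \<le> B \<Longrightarrow>
    (\<forall>ws. length ws \<le> ?k \<longrightarrow> set ws \<subseteq> Basis \<longrightarrow>
        (\<forall>u\<in>K. norm (iter_deriv ws G (\<phi> u)) \<le> B)) \<Longrightarrow>
        u \<in> K \<Longrightarrow>
    norm (iter_deriv vs (\<lambda>u. 1 *\<^sub>R G (\<phi> u)) u) \<le> C * B"
    using iter_deriv_compose_bound[OF U Ck\<phi> K Ck_const[OF U, of _ "1 :: real"], of vs] by blast
  \<comment> \<open>\<open>C\<close> may be 0, hence the denominator \<open>C + 1\<close>.\<close>
  define d where "d = \<delta> / (C + 1)"
  have d: "d > 0" using \<delta> C by (simp add: d_def)
  have "C * d < \<delta>" using \<delta> C by (simp add: d_def divide_simps)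
  have "norm (iter_deriv vs (\<lambda>w. g (\<phi> w) - f' (\<phi> w)) u) < e"
      if g: "Ck_close M ?k d f g" and u: "u \<in> K" for g u
  proof -
    obtain F G where FG: "Ck ?k UNIV F" "Ck ?k UNIV G" "\<forall>x\<in>M. F x = f x \<and> G x = g x"
      "\<forall>ws. length ws \<le> ?k \<longrightarrow> set ws \<subseteq> Basis \<longrightarrow>
          (\<forall>x\<in>M. norm (iter_deriv ws G x - iter_deriv ws F x) < d)"
      using g unfolding Ck_close_def by blast
    have uU: "u \<in> U" using u K by blast
    have CkGF: "Ck ?k UNIV (\<lambda>x. G x - F x)" by (intro Ck_diff open_UNIV FG)
    have "norm (iter_deriv ws (\<lambda>x. G x - F x) (\<phi> u)) \<le> d"
        if "length ws \<le> ?k" "set ws \<subseteq> Basis" "u \<in> K" for ws u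
    proof -
      have "iter_deriv ws (\<lambda>x. G x - F x) (\<phi> u) =
          iter_deriv ws G (\<phi> u) - iter_deriv ws F (\<phi> u)"
        using FG(1,2) Ck_le that(1) by (intro iter_deriv_diff[OF open_UNIV]) auto
      moreover have "\<phi> u \<in> M" using that im K by blast
      ultimately show ?thesis using FG(4) that by (simp add: less_imp_le)
    qed
    then have 1: "norm (iter_deriv vs (\<lambda>u. G (\<phi> u) - F (\<phi> u)) u) \<le> C * d"
      using C(2)[OF CkGF less_imp_le[OF d] _ u] by simp
    have "iter_deriv vs (\<lambda>w. g (\<phi> w) - f' (\<phi> w)) u =
        iter_deriv vs (\<lambda>w. (G (\<phi> w) - F (\<phi> w)) + (H (\<phi> w) - H' (\<phi> w))) u"
      using im H H' FG by (intro iter_deriv_cong[OF U _ uU]) (auto simp: image_subset_iff)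
    also have "\<dots> = iter_deriv vs (\<lambda>w. G (\<phi> w) - F (\<phi> w)) u + ?h u"
      by (intro iter_deriv_add[OF U] CkD FG H H' uU)
    also have "norm \<dots> \<le> C * d + norm (?h u0)"
      by (intro norm_triangle_mono 1 u0 u)
    finally show ?thesis using \<open>C * d < \<delta>\<close> by (simp add: \<delta>_def)
  qed
  then show ?thesis using d by blast
qed

lemma topspace_Cinf_topology: "topspace (Cinf_topology TYPE('d::finite) M) = Cinf M"
proof -
  \<comment> \<open>The empty chart with \<open>K = {}\<close> imposes no condition, so its subbasic
    set is all of \<open>Cinf M\<close>.\<close>
  have "local_param M ({} :: (real ^ 'd) set) (\<lambda>_. undefined)"
    by (simp add: local_param_def smooth_on_open_def smooth_on_set_def differentiable_on_def)
  then have "f \<in> topspace (Cinf_topology TYPE('d) M)" if "f \<in> Cinf M" for f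
    using that unfolding Cinf_topology_def topology_generated_by_topspace
    by (intro UnionI[of "Cinf M"] CollectI) (rule exI[of _ f], rule exI[of _ "{}"],
        rule exI[of _ "\<lambda>_. undefined"],
      rule exI[of _ "{}"], rule exI[of _ "[]"], rule exI[of _ 1], auto)
  moreover have "topspace (Cinf_topology TYPE('d) M) \<subseteq> Cinf M"
    unfolding Cinf_topology_def topology_generated_by_topspace by auto
  ultimately show ?thesis by blast
qed

text \<open>Induction over the generated topology; an intersection takes the larger order and the
  smaller tolerance.\<close>

lemma openin_Cinf_topology_Ck_nbhd:
  fixes M :: "'a::euclidean_space set"
  assumes M: "compact M" and W: "openin (Cinf_topology TYPE('d::finite) M) W" and f: "f \<in> W"
  shows "\<exists>k e. 0 < e \<and> (\<forall>g\<in>Cinf M. Ck_close M k e f g \<longrightarrow> g \<in> W)"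
  using W[unfolded Cinf_topology_def openin_topology_generated_by_iff] f
proof (induction rule: generate_topology_on.induct)
  case (Int a b)
  obtain j d where a: "0 < d" "\<forall>g\<in>Cinf M. Ck_close M j d f g \<longrightarrow> g \<in> a"
      using Int by blast
  obtain k e where b: "0 < e" "\<forall>g\<in>Cinf M. Ck_close M k e f g \<longrightarrow> g \<in> b"
      using Int by blast
  show ?case
    using a b by (intro exI[of _ "max j k"] exI[of _ "min d e"]) 
      (simp, blast intro: Ck_close_mono[OF _ max.cobounded1 min.cobounded1] Ck_close_mono[OF _
          max.cobounded2 min.cobounded2])
next
  case (UN \<K>)
  then show ?case by (meson UnionE UnionI)
next
  case (Basis s)
  then obtain f' U \<phi> K vs e where s: "s =
      {g \<in> Cinf M. \<forall>u\<in>K. norm (iter_deriv vs (\<lambda>w. g (\<phi> w) - f' (\<phi> w)) u) < e}"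
    "f' \<in> Cinf M" "local_param M (U :: (real ^ 'd) set) \<phi>" "compact K" "K \<subseteq> U"
    by blast
  have "f \<in> Cinf M" "\<forall>u\<in>K. norm (iter_deriv vs (\<lambda>w. f (\<phi> w) - f'
      (\<phi> w)) u) < e"
    using Basis.prems unfolding s(1) by auto
  from Cinf_subbasic_Ck_nbhd[OF M this(1) s(2-5) this(2)]
  show ?case unfolding s(1) by blast
qed simp

text \<open>The chart dimension stays arbitrary, since charts enter only through neighbourhoods
  given by \<open>Ck_close\<close>.\<close>

lemma polynomials_dense:
  "Cinf_topology TYPE('d::finite) P2O closure_of (restr ` allpoly) = Cinf P2O"
proof
  let ?T = "Cinf_topology TYPE('d) P2O"
  show "?T closure_of (restr ` allpoly) \<subseteq> Cinf P2O"
    using closure_of_subset_topspace[of ?T] by (simp add: topspace_Cinf_topology)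
  show "Cinf P2O \<subseteq> ?T closure_of (restr ` allpoly)"
  proof
    fix f assume f: "f \<in> Cinf P2O"
    have "\<exists>g\<in>restr ` allpoly. g \<in> W" if W: "f \<in> W" "openin ?T W" for W
    proof -
      obtain k e where ke: "0 < e" "\<And>g. g \<in> Cinf P2O \<Longrightarrow>
          Ck_close P2O k e f g \<Longrightarrow> g \<in> W"
        using openin_Cinf_topology_Ck_nbhd[OF compact_P2O W(2,1)] by blast
      obtain F where F: "Ck k UNIV F" "\<forall>x\<in>P2O. F x = f x" "bounded {x. F x \<noteq> 0}"
        using smooth_on_set_extension[OF compact_P2O, of f k] f unfolding Cinf_def by blast
      \<comment> \<open>Including 0 in the open box forces every component of \<open>a\<close> to be
        positive.\<close>
      have "bounded (insert 0 (P2O \<union> {x. F x \<noteq> 0}))"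
        using F compact_P2O by (simp add: compact_imp_bounded)
      then obtain a where a: "insert 0 (P2O \<union> {x. F x \<noteq> 0}) \<subseteq> box (- a) a"
        using bounded_subset_box_symmetric by blast
      then have "a \<bullet> i > 0" if "i \<in> Basis" for i using that by (auto simp: mem_box)
      moreover have "F x = 0" if "x \<notin> cbox (- a) a" for x using that a box_subset_cbox by blast
      ultimately obtain L where L: "\<forall>(p, c)\<in>set L. real_polynomial_function p"
        "\<forall>ws. length ws \<le> k \<longrightarrow> set ws \<subseteq> Basis \<longrightarrow>
          (\<forall>x\<in>box (- a) a. norm (iter_deriv ws (poly_comb L) x - iter_deriv ws F x) < e)"
        using Ck_polynomial_approx[OF F(1) _ _ ke(1), of a] by blast
      obtain Q where Q: "Q \<in> allpoly" "\<forall>A. peval Q A = poly_comb L A"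
        using poly_comb_peval[OF L(1)] by blast
      then have "poly_comb L = peval Q" by auto
      then have "Ck_close P2O k e f (restr Q)"
        unfolding Ck_close_def using F L(2) a Ck_peval[of k Q]
        by (intro exI[of _ F] exI[of _ "peval Q"]) (auto simp: restr_def)
      then show ?thesis using ke(2) restr_in_Cinf Q by blast
    qed
    then show "f \<in> ?T closure_of (restr ` allpoly)"
      using f by (auto simp: in_closure_of topspace_Cinf_topology)
  qed
qed

text \<open>The number 16 is the real dimension of the projective plane.\<close>

theorem theorem8p22:
  shows "(\<forall>k. \<forall>Q\<in>invpoly k. peval Q constant_on P2O)
    \<and> (\<forall>k. hompoly k = {h + q | h q. h \<in> harmonic k \<and>
          q \<in> cpoly_span (\<Union>i\<in>{..<k}. span_products (harmonic i) (invpoly (k - i)))})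
    \<and> restr ` allpoly = sum_spaces (\<lambda>k. restr ` harmonic k)
    \<and> restr ` allpoly \<subseteq> Cinf P2O
    \<and> Cinf_topology TYPE(16) P2O closure_of (restr ` allpoly) = Cinf P2O"
  using invpoly_constant_on hompoly_decomposition[unfolded inv_ideal_def] restr_allpoly_eq restr_in_Cinf
      polynomials_dense
  by (intro conjI allI ballI) blast+

end
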